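(* Let $X$ be a topological space and $B\subset A\subset X$ with $\mathrm{Cl}(B)\subset\mathrm{Int}(A)$, and let $i:(X\setminus B,A\setminus B)\hookrightarrow(X,A)$ be the inclusion. Let $L=1$ and $\vec m=(a,b)\in\mathcal R^2$ where $(a,b)$ satisfies condition $\mathcal{NCD}$. Then for every $n\ge0$ the induced map $i_*:{}_{\vec m}\mathcal H_n(X\setminus B,A\setminus B)\to{}_{\vec m}\mathcal H_n(X,A)$ is an isomorphism.
   Context: $\mathcal R$ is a commutative ring with unit. $(a,b)\in\mathcal R^2$ satisfies $\mathcal{NCD}$ if for every $n\in\mathbb N$ there exist $x_n,y_n\in\mathcal R$ with $x_na^n+y_nb^n=1_{\mathcal R}$. For a space $X$: $\mathcal S_n(X)$ = continuous maps $[0,1]^n\to X$ ($[0,1]^0=\{0\}$), $\mathcal K_n(X)$ the free $\mathcal R$-module on $\mathcal S_n(X)$, $\mathcal K_{-1}(X)=0$. With $L=1$, for $n\ge1$, $T\in\mathcal S_n(X)$, $i\in\{0,1\}$, $1\le j\le n$: $\langle T\rangle_{n,i,j}(x_1,\dots,x_{n-1})=T(x_1,\dots,x_{j-1},i,x_j,\dots,x_{n-1})$ (for $n=1$: $\langle T\rangle_{1,i,1}(0)=T(i)$), and $\partial_n(T)=\sum_{j=1}^n(-1)^{j+1}(a\langle T\rangle_{n,0,j}+b\langle T\rangle_{n,1,j})$, extended linearly, $\partial_0=0$; $\partial\circ\partial=0$. For a pair $(X,A)$, $\mathcal K_n(X,A)=\mathcal K_n(X)/\mathcal K_n(A)$ with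 the induced boundary, and ${}_{\vec m}\mathcal H_n(X,A)=\ker\partial_n/\operatorname{im}\partial_{n+1}$; a map of pairs $f$ induces $f_*$ via $T\mapsto f\circ T$. *)

theory Defs
  imports "HOL-Analysis.Analysis"
begin

definition NCD :: "'r::comm_ring_1 \<Rightarrow> 'r \<Rightarrow> bool" where
  "NCD a b \<longleftrightarrow> (\<forall>n::nat. \<exists>x y. x * a ^ n + y * b ^ n = 1)"

text \<open>The standard cube [0,1]^n, coordinates x_1..x_n stored at indices 0..n-1,
  all other coordinates 0 (so [0,1]^0 = the single point 0).\<close>
definition std_cube :: "nat \<Rightarrow> (nat \<Rightarrow> real) set" where
  "std_cube n = {x. (\<forall>i<n. 0 \<le> x i \<and> x i \<le> 1) \<and> (\<forall>i\<ge>n. x i = 0)}"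

definition singular_cube :: "nat \<Rightarrow> 'a topology \<Rightarrow> ((nat \<Rightarrow> real) \<Rightarrow> 'a) \<Rightarrow> bool" where
  "singular_cube n X T \<longleftrightarrow>
     continuous_map (subtopology (powertop_real UNIV) (std_cube n)) X T \<and> T \<in> extensional (std_cube n)"

definition cube_ins :: "nat \<Rightarrow> real \<Rightarrow> (nat \<Rightarrow> real) \<Rightarrow> (nat \<Rightarrow> real)" where
  "cube_ins k t x = (\<lambda>m. if m < k then x m else if m = k then t else x (m - 1))"

text \<open>Face: cube_face n (j-1) i T is the face with the j-th coordinate (1-based) set to i.\<close>
definition cube_face :: "nat \<Rightarrow> nat \<Rightarrow> real \<Rightarrow> ((nat \<Rightarrow> real) \<Rightarrow> 'a) \<Rightarrow> ((nat \<Rightarrow> real) \<Rightarrow> 'a)" where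
  "cube_face n k t T = restrict (T \<circ> cube_ins k t) (std_cube (n - 1))"

definition chains :: "nat \<Rightarrow> 'a topology \<Rightarrow> (((nat \<Rightarrow> real) \<Rightarrow> 'a) \<Rightarrow> 'r::comm_ring_1) set" where
  "chains n X = {c. finite {T. c T \<noteq> 0} \<and> (\<forall>T. c T \<noteq> 0 \<longrightarrow> singular_cube n X T)}"

text \<open>The boundary with L = 1 and weights (a,b):
  d_n T = sum_{j=1..n} (-1)^(j+1) (a <T>_{n,0,j} + b <T>_{n,1,j}), extended linearly; d_0 = 0.\<close>
definition chain_boundary :: "'r::comm_ring_1 \<Rightarrow> 'r \<Rightarrow> nat \<Rightarrow>
    (((nat \<Rightarrow> real) \<Rightarrow> 'a) \<Rightarrow> 'r) \<Rightarrow> (((nat \<Rightarrow> real) \<Rightarrow> 'a) \<Rightarrow> 'r)" where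
  "chain_boundary a b n c = (\<lambda>S. \<Sum>T\<in>{T. c T \<noteq> 0}. c T *
      (\<Sum>j<n. (-1) ^ j * (a * (if cube_face n j 0 T = S then 1 else 0)
                          + b * (if cube_face n j 1 T = S then 1 else 0))))"

text \<open>Relative cycles / boundaries of (X,A), represented in K_n(X) (preimages of
  ker and im of the induced boundary on K_n(X)/K_n(A)).\<close>
definition rel_cycles :: "'r::comm_ring_1 \<Rightarrow> 'r \<Rightarrow> nat \<Rightarrow> 'a topology \<Rightarrow> 'a set \<Rightarrow>
    (((nat \<Rightarrow> real) \<Rightarrow> 'a) \<Rightarrow> 'r) set" where
  "rel_cycles a b n X A =
     {c \<in> chains n X. chain_boundary a b n c \<in> chains (n - 1) (subtopology X A)}"

definition rel_boundaries :: "'r::comm_ring_1 \<Rightarrow> 'r \<Rightarrow> nat \<Rightarrow> 'a topology \<Rightarrow> 'a set \<Rightarrow>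
    (((nat \<Rightarrow> real) \<Rightarrow> 'a) \<Rightarrow> 'r) set" where
  "rel_boundaries a b n X A =
     {(\<lambda>T. chain_boundary a b (Suc n) d T + e T) | d e. d \<in> chains (Suc n) X \<and> e \<in> chains n (subtopology X A)}"

definition hom_class :: "'r::comm_ring_1 \<Rightarrow> 'r \<Rightarrow> nat \<Rightarrow> 'a topology \<Rightarrow> 'a set \<Rightarrow>
    (((nat \<Rightarrow> real) \<Rightarrow> 'a) \<Rightarrow> 'r) \<Rightarrow> (((nat \<Rightarrow> real) \<Rightarrow> 'a) \<Rightarrow> 'r) set" where
  "hom_class a b n X A c = {c'. (\<lambda>T. c' T - c T) \<in> rel_boundaries a b n X A}"

definition rel_homology :: "'r::comm_ring_1 \<Rightarrow> 'r \<Rightarrow> nat \<Rightarrow> 'a topology \<Rightarrow> 'a set \<Rightarrow>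
    (((nat \<Rightarrow> real) \<Rightarrow> 'a) \<Rightarrow> 'r) set set" where
  "rel_homology a b n X A = hom_class a b n X A ` rel_cycles a b n X A"

definition hom_add :: "'r::comm_ring_1 \<Rightarrow> 'r \<Rightarrow> nat \<Rightarrow> 'a topology \<Rightarrow> 'a set \<Rightarrow>
    (((nat \<Rightarrow> real) \<Rightarrow> 'a) \<Rightarrow> 'r) set \<Rightarrow> (((nat \<Rightarrow> real) \<Rightarrow> 'a) \<Rightarrow> 'r) set \<Rightarrow>
    (((nat \<Rightarrow> real) \<Rightarrow> 'a) \<Rightarrow> 'r) set" where
  "hom_add a b n X A C D = {e. \<exists>c\<in>C. \<exists>d\<in>D. (\<lambda>T. e T - (c T + d T)) \<in> rel_boundaries a b n X A}"

definition hom_scale :: "'r::comm_ring_1 \<Rightarrow> 'r \<Rightarrow> nat \<Rightarrow> 'a topology \<Rightarrow> 'a set \<Rightarrow> 'r \<Rightarrow>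
    (((nat \<Rightarrow> real) \<Rightarrow> 'a) \<Rightarrow> 'r) set \<Rightarrow> (((nat \<Rightarrow> real) \<Rightarrow> 'a) \<Rightarrow> 'r) set" where
  "hom_scale a b n X A r C = {e. \<exists>c\<in>C. (\<lambda>T. e T - r * c T) \<in> rel_boundaries a b n X A}"

definition chain_map :: "nat \<Rightarrow> ('a \<Rightarrow> 'b) \<Rightarrow> (((nat \<Rightarrow> real) \<Rightarrow> 'a) \<Rightarrow> 'r::comm_ring_1) \<Rightarrow>
    (((nat \<Rightarrow> real) \<Rightarrow> 'b) \<Rightarrow> 'r)" where
  "chain_map n f c = (\<lambda>S. \<Sum>T\<in>{T. c T \<noteq> 0 \<and> restrict (f \<circ> T) (std_cube n) = S}. c T)"

definition hom_induced :: "'r::comm_ring_1 \<Rightarrow> 'r \<Rightarrow> nat \<Rightarrow> 'b topology \<Rightarrow> 'b set \<Rightarrow> ('a \<Rightarrow> 'b) \<Rightarrow>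
    (((nat \<Rightarrow> real) \<Rightarrow> 'a) \<Rightarrow> 'r) set \<Rightarrow> (((nat \<Rightarrow> real) \<Rightarrow> 'b) \<Rightarrow> 'r) set" where
  "hom_induced a b n Y B f C = {d. \<exists>c\<in>C. (\<lambda>S. d S - chain_map n f c S) \<in> rel_boundaries a b n Y B}"

end

theory Submission
  imports Defs
begin

text \<open>Since \<open>x a + y b = 1\<close> for some \<open>x\<close> and \<open>y\<close>, the interval carries, for every \<open>N\<close>, a 1-chain \<open>s\<close> of
  paths of length at most \<open>1/N\<close> with boundary \<open>a [0] + b [1]\<close> and coefficient sum \<open>1\<close>, and coning
  produces a 2-chain \<open>\<eta>\<close> with boundary \<open>s - id\<close>.  (The coefficient sum matters: the homology of a
  point need not vanish in positive degrees.)  Applying \<open>s\<close> in every coordinate of a cube is a natural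
  chain map, and applying \<open>s\<close> in the first \<open>k\<close> coordinates and \<open>\<eta>\<close> in the next one, summed over \<open>k\<close>
  with signs, is a natural homotopy from it to the identity.  For large \<open>N\<close> every resulting cube lies
  in the interior of \<open>A\<close> or misses the closure of \<open>B\<close>, and excision follows as usual.  No iterated
  subdivision is needed.

  Operators are given by their transposes, acting on arbitrary functions \<open>\<phi>\<close> on cubes, so composites
  appear in reverse order; \<open>finitary\<close> ensures that such a transpose comes from a map of chains,
  namely \<open>push\<close>.\<close>

section \<open>Finite linear combinations and operators dual to them\<close>

text \<open>A list of weighted points stands for a formal linear combination. Only its evaluation on
  functions matters, so repetitions and zero weights are harmless.\<close>

definition lsum :: "('r::comm_ring_1 \<times> 'c) list \<Rightarrow> ('c \<Rightarrow> 'r) \<Rightarrow> 'r" where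
  "lsum l \<phi> = (\<Sum>(r, t)\<leftarrow>l. r * \<phi> t)"

lemma lsum_Nil [simp]: "lsum [] \<phi> = 0"
  by (simp add: lsum_def)

lemma lsum_Cons [simp]: "lsum ((r, t) # l) \<phi> = r * \<phi> t + lsum l \<phi>"
  by (simp add: lsum_def)

lemma lsum_append [simp]: "lsum (l @ l') \<phi> = lsum l \<phi> + lsum l' \<phi>"
  by (simp add: lsum_def)

lemma lsum_cong: "(\<And>t. t \<in> snd ` set l \<Longrightarrow> \<phi> t = \<psi> t) \<Longrightarrow> lsum l \<phi> = lsum l \<psi>"
  by (induction l) auto

lemma lsum_add: "lsum l (\<lambda>t. \<phi> t + \<psi> t) = lsum l \<phi> + lsum l \<psi>"
  by (induction l) (auto simp: algebra_simps)

lemma lsum_diff: "lsum l (\<lambda>t. \<phi> t - \<psi> t) = lsum l \<phi> - lsum l \<psi>"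
  by (induction l) (auto simp: algebra_simps)

lemma lsum_mult: "lsum l (\<lambda>t. c * \<phi> t) = c * lsum l \<phi>"
  by (induction l) (auto simp: algebra_simps)

lemma lsum_sum: "lsum l (\<lambda>t. \<Sum>j\<in>J. f j t) = (\<Sum>j\<in>J. lsum l (f j))"
  by (induction l) (auto simp: sum_distrib_left sum.distrib)

lemma lsum_zero [simp]: "lsum l (\<lambda>_. 0) = 0"
  by (induction l) auto

lemma lsum_map: "lsum (map (\<lambda>(r, t). (c * r, f t)) l) \<phi> = c * lsum l (\<lambda>t. \<phi> (f t))"
  by (induction l) (auto simp: algebra_simps)

text \<open>Substitutes a combination for every point of another one. Composition of operators and
  linear extension of the cone both take this form.\<close>

lemma lsum_bind:
  "lsum (concat (map (\<lambda>(r, t). map (\<lambda>(r', t'). (r * r', t')) (f t)) l)) \<phi>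
   = lsum l (\<lambda>t. lsum (f t) \<phi>)"
  by (induction l) (auto simp: lsum_map[of _ "\<lambda>t. t"])

text \<open>Besides all singular cubes of a space, \<open>Q\<close> will be the cubes lying in one
  or the other of two open sets, in general not the cubes of a single subspace.\<close>

definition chain_on :: "'c set \<Rightarrow> ('c \<Rightarrow> 'r::comm_ring_1) set" where
  "chain_on Q = {c. finite {T. c T \<noteq> 0} \<and> (\<forall>T. c T \<noteq> 0 \<longrightarrow> T \<in> Q)}"

lemma chains_eq_chain_on: "chains n X = chain_on (Collect (singular_cube n X))"
  by (simp add: chains_def chain_on_def)

lemma chain_on_add: "c \<in> chain_on Q \<Longrightarrow> d \<in> chain_on Q \<Longrightarrow> (\<lambda>T. c T + d T) \<in> chain_on Q"
proof -
  assume cd: "c \<in> chain_on Q" "d \<in> chain_on Q"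
  have "{T. c T + d T \<noteq> 0} \<subseteq> {T. c T \<noteq> 0} \<union> {T. d T \<noteq> 0}" by auto
  with cd show ?thesis
    unfolding chain_on_def by (simp add: finite_subset) (metis add.right_neutral)
qed

lemma chain_on_scale: "c \<in> chain_on Q \<Longrightarrow> (\<lambda>T. r * c T) \<in> chain_on Q"
proof -
  assume c: "c \<in> chain_on Q"
  have "{T. r * c T \<noteq> 0} \<subseteq> {T. c T \<noteq> 0}" by auto
  with c show ?thesis
    unfolding chain_on_def by (simp add: finite_subset) (metis mult_zero_right)
qed

lemma chain_on_minus: "c \<in> chain_on Q \<Longrightarrow> (\<lambda>T. - c T) \<in> chain_on Q"
  by (simp add: chain_on_def)

lemma chain_on_diff: "c \<in> chain_on Q \<Longrightarrow> d \<in> chain_on Q \<Longrightarrow> (\<lambda>T. c T - d T) \<in> chain_on Q"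
  using chain_on_add[OF _ chain_on_minus, of c Q d] by simp

lemma chain_on_zero: "(\<lambda>T. 0) \<in> chain_on Q"
  by (simp add: chain_on_def)

definition pair :: "('c \<Rightarrow> 'r::comm_ring_1) \<Rightarrow> ('c \<Rightarrow> 'r) \<Rightarrow> 'r" where
  "pair c \<phi> = (\<Sum>T | c T \<noteq> 0. c T * \<phi> T)"

definition delta :: "'c \<Rightarrow> 'c \<Rightarrow> 'r::comm_ring_1" where
  "delta S T = (if T = S then 1 else 0)"

lemma pair_superset:
  assumes "finite W" "{T. c T \<noteq> 0} \<subseteq> W"
  shows "pair c \<phi> = (\<Sum>T\<in>W. c T * \<phi> T)"
  unfolding pair_def by (rule sum.mono_neutral_left) (use assms in auto)

lemma pair_delta: "c \<in> chain_on Q \<Longrightarrow> pair c (delta S) = c S"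
  unfolding chain_on_def
  by (subst pair_superset[where W = "insert S {T. c T \<noteq> 0}"])
     (auto simp: delta_def if_distrib cong: if_cong)

lemma pair_add_left:
  assumes "c \<in> chain_on Q" "d \<in> chain_on Q"
  shows "pair (\<lambda>T. c T + d T) \<phi> = pair c \<phi> + pair d \<phi>"
proof -
  let ?W = "{T. c T \<noteq> 0} \<union> {T. d T \<noteq> 0}"
  have "finite ?W" using assms by (auto simp: chain_on_def)
  then show ?thesis
    by (subst (1 2 3) pair_superset[where W = ?W]) (auto simp: algebra_simps sum.distrib)
qed

lemma pair_scale_left:
  assumes "c \<in> chain_on Q"
  shows "pair (\<lambda>T. r * c T) \<phi> = r * pair c \<phi>"
proof -
  let ?W = "{T. c T \<noteq> 0}"
  have "finite ?W" using assms by (auto simp: chain_on_def)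
  then show ?thesis
    by (subst (1 2) pair_superset[where W = ?W]) (auto simp: algebra_simps sum_distrib_left)
qed

lemma pair_cong: "c \<in> chain_on P \<Longrightarrow> (\<And>T. T \<in> P \<Longrightarrow> \<phi> T = \<psi> T) \<Longrightarrow> pair c \<phi> = pair c \<psi>"
  by (auto simp: pair_def chain_on_def intro!: sum.cong)

lemma pair_add_right: "pair c (\<lambda>T. \<phi> T + \<psi> T) = pair c \<phi> + pair c \<psi>"
  by (simp add: pair_def algebra_simps sum.distrib)

lemma pair_diff_right: "pair c (\<lambda>T. \<phi> T - \<psi> T) = pair c \<phi> - pair c \<psi>"
  by (simp add: pair_def algebra_simps sum_subtractf)

section \<open>Operators that are transposes of maps of chains\<close>

definition finitary :: "'c set \<Rightarrow> 'd set \<Rightarrow> (('d \<Rightarrow> 'r::comm_ring_1) \<Rightarrow> 'c \<Rightarrow> 'r) \<Rightarrow> bool" where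
  "finitary P Q F \<longleftrightarrow> (\<forall>T\<in>P. \<exists>l. snd ` set l \<subseteq> Q \<and> (\<forall>\<phi>. F \<phi> T = lsum l \<phi>))"

text \<open>The coefficient of \<open>S\<close> in the image chain is read off by testing with the
  indicator of \<open>S\<close>.\<close>

definition push :: "(('d \<Rightarrow> 'r) \<Rightarrow> 'c \<Rightarrow> 'r) \<Rightarrow> ('c \<Rightarrow> 'r::comm_ring_1) \<Rightarrow> 'd \<Rightarrow> 'r" where
  "push F c = (\<lambda>S. pair c (F (delta S)))"

lemma finitary_mono: "finitary P Q F \<Longrightarrow> P' \<subseteq> P \<Longrightarrow> Q \<subseteq> Q' \<Longrightarrow> finitary P' Q' F"
  unfolding finitary_def by (meson subset_iff subset_trans)

lemma finitary_lsum:
  assumes "\<And>g T. g \<in> snd ` set s \<Longrightarrow> T \<in> P \<Longrightarrow> f g T \<in> Q"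
  shows "finitary P Q (\<lambda>\<phi> T. lsum s (\<lambda>g. \<phi> (f g T)))"
  unfolding finitary_def
proof
  fix T assume "T \<in> P"
  with assms show "\<exists>l. snd ` set l \<subseteq> Q \<and> (\<forall>\<phi>. lsum s (\<lambda>g. \<phi> (f g T)) = lsum l \<phi>)"
    by (intro exI[where x = "map (\<lambda>(r, g). (1 * r, f g T)) s"])
       (auto simp: lsum_map[of 1, simplified] image_iff split: prod.splits, force)
qed

lemma finitary_point: "f ` P \<subseteq> Q \<Longrightarrow> finitary P Q (\<lambda>\<phi> T. \<phi> (f T))"
  unfolding finitary_def by (auto intro!: exI[where x = "[(1, f _)]"])

text \<open>On chains \<open>F\<close> acts first: each entry of its list is then replaced by a list
  for \<open>G\<close>.\<close>

lemma finitary_comp: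
  assumes F: "finitary P Q F" and G: "finitary Q R G"
  shows "finitary P R (\<lambda>\<phi>. F (G \<phi>))"
  unfolding finitary_def
proof
  fix T assume "T \<in> P"
  then obtain l where l: "snd ` set l \<subseteq> Q" "\<And>\<phi>. F \<phi> T = lsum l \<phi>"
    using F by (auto simp: finitary_def)
  obtain f where f: "\<And>t. t \<in> Q \<Longrightarrow> snd ` set (f t) \<subseteq> R \<and> (\<forall>\<phi>. G \<phi> t = lsum (f t) \<phi>)"
    using G unfolding finitary_def by metis
  let ?l = "concat (map (\<lambda>(r, t). map (\<lambda>(r', t'). (r * r', t')) (f t)) l)"
  have "F (G \<phi>) T = lsum ?l \<phi>" for \<phi>
    unfolding lsum_bind l by (rule lsum_cong) (use l f in auto)
  moreover have "snd ` set ?l \<subseteq> R"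
    using l(1) f by (fastforce simp: image_subset_iff)
  ultimately show "\<exists>l. snd ` set l \<subseteq> R \<and> (\<forall>\<phi>. F (G \<phi>) T = lsum l \<phi>)"
    by blast
qed

lemma finitary_scale:
  assumes "finitary P Q F"
  shows "finitary P Q (\<lambda>\<phi> T. c * F \<phi> T)"
  unfolding finitary_def
proof
  fix T assume "T \<in> P"
  then obtain l where l: "snd ` set l \<subseteq> Q" "\<And>\<phi>. F \<phi> T = lsum l \<phi>"
    using assms by (auto simp: finitary_def)
  then show "\<exists>l. snd ` set l \<subseteq> Q \<and> (\<forall>\<phi>. c * F \<phi> T = lsum l \<phi>)"
    by (intro exI[where x = "map (\<lambda>(r, t). (c * r, id t)) l"])
       (force simp: lsum_map[of c id, simplified])
qed

lemma finitary_add: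
  assumes "finitary P Q F" "finitary P Q G"
  shows "finitary P Q (\<lambda>\<phi> T. F \<phi> T + G \<phi> T)"
  unfolding finitary_def
proof
  fix T assume "T \<in> P"
  then obtain l l' where "snd ` set l \<subseteq> Q" "\<And>\<phi>. F \<phi> T = lsum l \<phi>"
     "snd ` set l' \<subseteq> Q" "\<And>\<phi>. G \<phi> T = lsum l' \<phi>"
    using assms unfolding finitary_def by metis
  then show "\<exists>l. snd ` set l \<subseteq> Q \<and> (\<forall>\<phi>. F \<phi> T + G \<phi> T = lsum l \<phi>)"
    by (intro exI[where x = "l @ l'"]) auto
qed

lemma finitary_sum:
  assumes "\<And>j. j < n \<Longrightarrow> finitary P Q (F j)"
  shows "finitary P Q (\<lambda>\<phi> T. \<Sum>j<n::nat. (c j :: 'r::comm_ring_1) * F j \<phi> T)"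
  using assms
proof (induction n)
  case 0
  show ?case by (auto simp: finitary_def intro!: exI[where x = "[]"])
next
  case (Suc n)
  then show ?case
    by (simp add: finitary_add finitary_scale)
qed

lemma finitary_linear:
  assumes "finitary P Q F" "T \<in> P"
  shows "F (\<lambda>S. \<Sum>j\<in>J. c j * f j S) T = (\<Sum>j\<in>J. c j * F (f j) T)"
proof -
  obtain l where "\<And>\<phi>. F \<phi> T = lsum l \<phi>"
    using assms by (auto simp: finitary_def)
  then show ?thesis by (simp add: lsum_sum lsum_mult)
qed

lemma lsum_delta_expand:
  assumes "finite W" "snd ` set l \<subseteq> W"
  shows "(\<Sum>S\<in>W. lsum l (delta S) * \<phi> S) = lsum l \<phi>"
  using assms
proof (induction l)
  case (Cons p l)
  obtain r t where p: "p = (r, t)" by fastforce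
  have "(\<Sum>S\<in>W. r * delta S t * \<phi> S) = r * \<phi> t"
    using Cons.prems p by (simp add: delta_def if_distrib if_distribR cong: if_cong)
  with Cons p show ?case by (simp add: distrib_right sum.distrib)
qed simp

text \<open>\<open>push F\<close> is adjoint to \<open>F\<close>: once the support of the image is
  enclosed in a finite set, this is an exchange of two finite sums. It turns identities between
  transposes into identities between chains.\<close>

lemma
  assumes F: "finitary P Q F" and c: "c \<in> chain_on P"
  shows push_chain_on: "push F c \<in> chain_on Q"
    and pair_push: "pair (push F c) \<phi> = pair c (F \<phi>)"
proof -
  obtain l where l: "\<And>T. T \<in> P \<Longrightarrow> snd ` set (l T) \<subseteq> Q \<and> (\<forall>\<phi>. F \<phi> T = lsum (l T) \<phi>)"
    using F unfolding finitary_def by metis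
  define C where "C = {T. c T \<noteq> 0}"
  have C: "finite C" "C \<subseteq> P" using c by (auto simp: chain_on_def C_def)
  \<comment> \<open>Terms may cancel, so this only encloses the support of
    \<open>push F c\<close>.\<close>
  define W where "W = (\<Union>T\<in>C. snd ` set (l T))"
  have W: "finite W" "W \<subseteq> Q" using C l by (auto simp: W_def)
  have eq: "pair c (F \<phi>) = (\<Sum>T\<in>C. c T * lsum (l T) \<phi>)" for \<phi>
    unfolding pair_def C_def[symmetric] by (rule sum.cong) (use C l in auto)
  have "push F c S = 0" if "S \<notin> W" for S
  proof -
    have "lsum (l T) (delta S) = 0" if "T \<in> C" for T
    proof -
      have "lsum (l T) (delta S) = lsum (l T) (\<lambda>_. 0)"
        using that \<open>S \<notin> W\<close> by (intro lsum_cong) (auto simp: delta_def W_def)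
      then show ?thesis by simp
    qed
    then show ?thesis by (simp add: push_def eq)
  qed
  then have supp: "{S. push F c S \<noteq> 0} \<subseteq> W" by auto
  then show "push F c \<in> chain_on Q"
    using W finite_subset unfolding chain_on_def by blast
  have "pair (push F c) \<phi> = (\<Sum>S\<in>W. \<Sum>T\<in>C. c T * (lsum (l T) (delta S) * \<phi> S))"
    unfolding pair_superset[OF W(1) supp] by (simp add: push_def eq sum_distrib_right mult.assoc)
  also have "\<dots> = (\<Sum>T\<in>C. c T * (\<Sum>S\<in>W. lsum (l T) (delta S) * \<phi> S))"
    by (subst sum.swap) (simp add: sum_distrib_left)
  also have "\<dots> = pair c (F \<phi>)"
    unfolding eq by (intro sum.cong refl arg_cong2[where f = "(*)"] lsum_delta_expand W)
      (auto simp: W_def)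
  finally show "pair (push F c) \<phi> = pair c (F \<phi>)" .
qed

lemma push_add:
  assumes "c \<in> chain_on Q" "d \<in> chain_on Q"
  shows "push F (\<lambda>T. c T + d T) = (\<lambda>S. push F c S + push F d S)"
  unfolding push_def by (simp add: pair_add_left[OF assms])

lemma push_scale:
  assumes "c \<in> chain_on Q"
  shows "push F (\<lambda>T. r * c T) = (\<lambda>S. r * push F c S)"
  unfolding push_def by (simp add: pair_scale_left[OF assms])

section \<open>Fine chains on the interval\<close>

text \<open>Smallness bounds the diameter of the image, which is what a Lebesgue number argument
  uses.\<close>

definition small_paths :: "real \<Rightarrow> (real \<Rightarrow> real) set" where
  "small_paths \<epsilon> = {g. continuous_on {0..1} g \<and> g ` {0..1} \<subseteq> {0..1}
     \<and> (\<forall>u\<in>{0..1}. \<forall>v\<in>{0..1}. \<bar>g u - g v\<bar> \<le> \<epsilon>)}"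

definition unit_squares :: "(real \<Rightarrow> real \<Rightarrow> real) set" where
  "unit_squares = {h. continuous_on ({0..1} \<times> {0..1}) (\<lambda>(u, t). h u t)
     \<and> (\<forall>u\<in>{0..1}. \<forall>t\<in>{0..1}. h u t \<in> {0..1})}"

lemma segment_in_small_paths:
  assumes "p \<in> {0..1}" "q \<in> {0..1}" "\<bar>q - p\<bar> \<le> \<epsilon>"
  shows "(\<lambda>t. p + t * (q - p)) \<in> small_paths \<epsilon>"
proof -
  have "p + t * (q - p) \<in> {0..1}" if "t \<in> {0..1}" for t :: real
  proof -
    have "(1 - t) *\<^sub>R p + t *\<^sub>R q \<in> {0..1}"
      using that assms by (intro convexD[of "{0..1::real}"]) auto
    then show ?thesis by (simp add: algebra_simps)
  qed
  moreover have "\<bar>(p + u * (q - p)) - (p + v * (q - p))\<bar> \<le> \<epsilon>" if "u \<in> {0..1}" "v \<in> {0..1}" for u v :: real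
  proof -
    have "\<bar>(p + u * (q - p)) - (p + v * (q - p))\<bar> = \<bar>u - v\<bar> * \<bar>q - p\<bar>"
      by (simp add: abs_mult[symmetric] algebra_simps)
    also have "\<dots> \<le> 1 * \<bar>q - p\<bar>"
      using that by (intro mult_right_mono) auto
    finally show ?thesis using assms by simp
  qed
  ultimately show ?thesis
    by (auto simp: small_paths_def intro!: continuous_intros)
qed

lemma const_in_small_paths: "p \<in> {0..1} \<Longrightarrow> \<epsilon> \<ge> 0 \<Longrightarrow> (\<lambda>_. p) \<in> small_paths \<epsilon>"
  by (auto simp: small_paths_def)

text \<open>The segments from \<open>p\<close> to \<open>q\<close> and from \<open>q\<close> to \<open>p\<close>, minus the constant path at \<open>p\<close>, have
  boundaries \<open>b (q - p)\<close> and \<open>a (q - p)\<close>.  With weights \<open>y\<close> and \<open>x\<close>, where \<open>x a + y b = 1\<close>, they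
  combine to a path with boundary exactly \<open>q - p\<close>, and such paths can be concatenated.\<close>

lemma fine_interval_chain:
  fixes a b x y :: "'r::comm_ring_1" and N :: nat
  assumes xy: "x * a + y * b = 1" and N: "N > 0"
  obtains s :: "('r \<times> (real \<Rightarrow> real)) list" where
    "snd ` set s \<subseteq> small_paths (1 / real N)"
    "\<And>\<phi>. lsum s (\<lambda>g. a * \<phi> (g 0) + b * \<phi> (g 1)) = a * \<phi> 0 + b * \<phi> 1"
    "lsum s (\<lambda>_. 1) = 1"
proof -
  \<comment> \<open>The induction moves the right end \<open>M / N\<close> one step at a time and
    keeps the coefficient sum \<open>1\<close>; \<open>M = N\<close> is the claim.\<close>
  have "\<exists>s :: ('r \<times> (real \<Rightarrow> real)) list. snd ` set s \<subseteq> small_paths (1 / real N)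
      \<and> (\<forall>\<phi>. lsum s (\<lambda>g. a * \<phi> (g 0) + b * \<phi> (g 1)) = a * \<phi> 0 + b * \<phi> (real M / real N))
      \<and> lsum s (\<lambda>_. 1) = 1" if "M \<le> N" for M
    using that
  proof (induction M)
    case 0
    show ?case
      by (intro exI[where x = "[(1, \<lambda>_. 0)]"]) (auto simp: const_in_small_paths)
  next
    case (Suc M)
    then obtain s :: "('r \<times> (real \<Rightarrow> real)) list" where s: "snd ` set s \<subseteq> small_paths (1 / real N)"
      "\<And>\<phi>. lsum s (\<lambda>g. a * \<phi> (g 0) + b * \<phi> (g 1)) = a * \<phi> 0 + b * \<phi> (real M / real N)"
      "lsum s (\<lambda>_. 1) = 1"
      by auto
    define p q where "p = real M / real N" and "q = real (Suc M) / real N"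
    have pq: "p \<in> {0..1}" "q \<in> {0..1}" "q - p = 1 / real N"
      using Suc.prems N by (auto simp: p_def q_def field_simps)
    \<comment> \<open>Only the term with factor \<open>b\<close> has to move from \<open>p\<close>
      to \<open>q\<close>, hence the factor \<open>b\<close> in all weights. The constant path also
      makes the coefficient sum of \<open>e\<close> zero.\<close>
    define e where "e = [(b * x, \<lambda>t. q + t * (p - q)), (b * y, \<lambda>t. p + t * (q - p)),
      (- (b * (x + y)), \<lambda>_. p)]"
    have "snd ` set e \<subseteq> small_paths (1 / real N)"
      using segment_in_small_paths[of p q "1 / real N"] segment_in_small_paths[of q p "1 / real N"]
        const_in_small_paths[of p "1 / real N"] pq
      by (simp add: e_def abs_minus_commute[of p q])
    moreover have "lsum e (\<lambda>g. a * \<phi> (g 0) + b * \<phi> (g 1)) = b * \<phi> q - b * \<phi> p" for \<phi>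
    proof -
      have "lsum e (\<lambda>g. a * \<phi> (g 0) + b * \<phi> (g 1)) = b * ((x * a + y * b) * (\<phi> q - \<phi> p))"
        by (simp add: e_def algebra_simps)
      then show ?thesis unfolding xy by (simp add: algebra_simps)
    qed
    moreover have "lsum e (\<lambda>_. 1) = 0"
      by (simp add: e_def algebra_simps)
    ultimately show ?case
      using s by (intro exI[where x = "s @ e"]) (auto simp: p_def q_def)
  qed
  from this[of N] that N show ?thesis by auto
qed

text \<open>The square with boundary \<open>s - id\<close> is the cone over \<open>id - s\<close> with apex \<open>0\<close>: the weights sum
  to \<open>1\<close>, so the apex terms cancel.\<close>

lemma fine_interval_homotopy:
  fixes a b x y :: "'r::comm_ring_1"
  assumes xy: "x * a + y * b = 1"
    and s: "snd ` set s \<subseteq> small_paths \<epsilon>"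
    and bd: "\<And>\<phi>. lsum s (\<lambda>g. a * \<phi> (g 0) + b * \<phi> (g 1)) = a * \<phi> 0 + b * \<phi> 1"
    and one: "lsum s (\<lambda>_. 1) = 1"
  obtains \<eta> :: "('r \<times> (real \<Rightarrow> real \<Rightarrow> real)) list" where
    "snd ` set \<eta> \<subseteq> unit_squares"
    "\<And>\<phi>. lsum \<eta> (\<lambda>h. (a * \<phi> (h 0) + b * \<phi> (h 1)) - (a * \<phi> (\<lambda>u. h u 0) + b * \<phi> (\<lambda>u. h u 1)))
         = lsum s \<phi> - \<phi> (\<lambda>u. u)"
proof -
  \<comment> \<open>The device of \<open>fine_interval_chain\<close>, now in direction
    \<open>t\<close>: the contraction to \<open>0\<close>, its reverse and a constant combine so
    that the \<open>t\<close>-boundary is exactly \<open>g\<close> minus the constant path at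
    \<open>0\<close>.\<close>
  define cone :: "(real \<Rightarrow> real) \<Rightarrow> ('r \<times> (real \<Rightarrow> real \<Rightarrow> real)) list" where
    "cone g = [(x, \<lambda>u t. (1 - t) * g u), (y, \<lambda>u t. t * g u), (- (x + y), \<lambda>u t. 0)]" for g
  define l where "l = (1, \<lambda>u. u) # map (\<lambda>(r, g). (- 1 * r, g)) s"
  define \<eta> where "\<eta> = concat (map (\<lambda>(r, t). map (\<lambda>(r', t'). (r * r', t')) (cone t)) l)"
  have l: "lsum l \<psi> = \<psi> (\<lambda>u. u) - lsum s \<psi>" for \<psi>
    unfolding l_def lsum_Cons lsum_map by simp
  have paths: "continuous_on {0..1} g \<and> g ` {0..1} \<subseteq> {0..1}" if "g \<in> snd ` set l" for g
    using that s by (force simp: l_def small_paths_def)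
  have "snd ` set (cone g) \<subseteq> unit_squares" if "g \<in> snd ` set l" for g
  proof -
    have c: "continuous_on ({0..1} \<times> {0..1}) (\<lambda>z::real \<times> real. g (fst z))"
      by (rule continuous_on_compose2[of "{0..1}" g]) (use paths[OF that] in \<open>auto intro!: continuous_intros\<close>)
    have g: "0 \<le> g u \<and> g u \<le> 1" if "0 \<le> u" "u \<le> 1" for u
      using paths[OF \<open>g \<in> _\<close>] that by force
    show ?thesis
      using c g by (auto simp: cone_def unit_squares_def case_prod_unfold mult_le_one intro!: continuous_intros)
  qed
  then have "snd ` set \<eta> \<subseteq> unit_squares"
    by (force simp: \<eta>_def image_subset_iff)
  moreover have "lsum \<eta> (\<lambda>h. (a * \<phi> (h 0) + b * \<phi> (h 1)) - (a * \<phi> (\<lambda>u. h u 0) + b * \<phi> (\<lambda>u. h u 1)))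
         = lsum s \<phi> - \<phi> (\<lambda>u. u)" (is "lsum \<eta> ?\<Psi> = _") for \<phi>
  proof -
    \<comment> \<open>The \<open>u\<close>-faces of \<open>cone g\<close> depend on \<open>g\<close>
      only through \<open>g 0\<close> and \<open>g 1\<close>. They are values of one function
      \<open>w\<close> of points, so \<open>bd\<close> applies and cancels the sides.\<close>
    define w where "w v = x * \<phi> (\<lambda>t. (1 - t) * v) + y * \<phi> (\<lambda>t. t * v) - (x + y) * \<phi> (\<lambda>_. 0)" for v
    have "lsum (cone g) ?\<Psi> = (a * w (g 0) + b * w (g 1)) - (\<phi> g - \<phi> (\<lambda>_. 0) * 1)" for g
    proof -
      have "lsum (cone g) ?\<Psi> = (a * w (g 0) + b * w (g 1)) - (x * a + y * b) * (\<phi> g - \<phi> (\<lambda>_. 0))"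
        by (simp add: cone_def w_def algebra_simps)
      then show ?thesis by (simp add: xy)
    qed
    then have "lsum \<eta> ?\<Psi> = lsum l (\<lambda>g. (a * w (g 0) + b * w (g 1)) - (\<phi> g - \<phi> (\<lambda>_. 0) * 1))"
      unfolding \<eta>_def lsum_bind by simp
    also have "\<dots> = lsum s \<phi> - \<phi> (\<lambda>u. u)"
      unfolding l lsum_diff bd lsum_mult one by (simp add: algebra_simps)
    finally show ?thesis .
  qed
  ultimately show ?thesis by (rule that)
qed

section \<open>Subdivision of cubes and its homotopy\<close>

definition cube_maps :: "nat \<Rightarrow> nat \<Rightarrow> ((nat \<Rightarrow> real) \<Rightarrow> nat \<Rightarrow> real) set" where
  "cube_maps m n = {G. continuous_on (std_cube m) G \<and> G ` std_cube m \<subseteq> std_cube n}"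

text \<open>Restriction keeps cubes extensional, so that maps agreeing on the cube are the same
  basis element.\<close>

definition pullback :: "nat \<Rightarrow> ((nat \<Rightarrow> real) \<Rightarrow> nat \<Rightarrow> real) \<Rightarrow> ((nat \<Rightarrow> real) \<Rightarrow> 'a) \<Rightarrow> (nat \<Rightarrow> real) \<Rightarrow> 'a" where
  "pullback m G T = restrict (T \<circ> G) (std_cube m)"

lemma pullback_pullback:
  "(\<And>x. x \<in> std_cube m \<Longrightarrow> G' x \<in> std_cube n)
    \<Longrightarrow> pullback m G' (pullback n G T) = pullback m (\<lambda>x. G (G' x)) T"
  by (auto simp: pullback_def restrict_def)

lemma pullback_id: "T \<in> extensional (std_cube n) \<Longrightarrow> pullback n (\<lambda>x. x) T = T"
  by (auto simp: pullback_def extensional_def restrict_def)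

lemma pullback_extensional: "pullback m G T \<in> extensional (std_cube m)"
  by (simp add: pullback_def)

lemma cube_face_eq_pullback: "cube_face n j t = pullback (n - 1) (cube_ins j t)"
  by (auto simp: cube_face_def pullback_def)

lemma singular_cube_pullback:
  assumes "singular_cube n X T" "G \<in> cube_maps m n"
  shows "singular_cube m X (pullback m G T)"
proof -
  have "continuous_map (subtopology (powertop_real UNIV) (std_cube m))
          (subtopology (powertop_real UNIV) (std_cube n)) G"
    using assms(2)
    by (auto simp: cube_maps_def euclidean_product_topology continuous_map_in_subtopology)
  then have "continuous_map (subtopology (powertop_real UNIV) (std_cube m)) X (T \<circ> G)"
    using assms(1) continuous_map_compose unfolding singular_cube_def by blast
  then have "continuous_map (subtopology (powertop_real UNIV) (std_cube m)) X (pullback m G T)"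
    by (rule continuous_map_eq) (simp add: pullback_def)
  then show ?thesis by (simp add: singular_cube_def pullback_def)
qed

section \<open>Reparametrising one or two coordinates of a cube\<close>

definition act_path :: "nat \<Rightarrow> (real \<Rightarrow> real) \<Rightarrow> (nat \<Rightarrow> real) \<Rightarrow> nat \<Rightarrow> real" where
  "act_path k g x = x(k := g (x k))"

text \<open>The parameters of the square occupy the adjacent positions \<open>k\<close> and
  \<open>Suc k\<close>, so its two pairs of faces enter the boundary with opposite signs, as in the
  boundary of \<open>\<eta>\<close>.\<close>

definition act_square :: "nat \<Rightarrow> (real \<Rightarrow> real \<Rightarrow> real) \<Rightarrow> (nat \<Rightarrow> real) \<Rightarrow> nat \<Rightarrow> real" where
  "act_square k h x = (\<lambda>m. if m < k then x m else if m = k then h (x k) (x (Suc k)) else x (Suc m))"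

definition unit_paths :: "(real \<Rightarrow> real) set" where
  "unit_paths = {g. continuous_on {0..1} g \<and> g ` {0..1} \<subseteq> {0..1}}"

lemma small_paths_subset: "small_paths \<epsilon> \<subseteq> unit_paths"
  by (auto simp: small_paths_def unit_paths_def)

lemma std_cubeD: "x \<in> std_cube n \<Longrightarrow> i < n \<Longrightarrow> x i \<in> {0..1}"
  by (simp add: std_cube_def)

lemma act_path_in_std_cube:
  "g \<in> unit_paths \<Longrightarrow> k < n \<Longrightarrow> x \<in> std_cube n \<Longrightarrow> act_path k g x \<in> std_cube n"
  by (auto simp: act_path_def std_cube_def unit_paths_def image_subset_iff)

lemma act_square_in_std_cube:
  "h \<in> unit_squares \<Longrightarrow> k < n \<Longrightarrow> x \<in> std_cube (Suc n) \<Longrightarrow> act_square k h x \<in> std_cube n"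
  by (auto simp: act_square_def std_cube_def unit_squares_def)

lemma cube_ins_in_std_cube:
  "t \<in> {0..1} \<Longrightarrow> j \<le> n \<Longrightarrow> x \<in> std_cube n \<Longrightarrow> cube_ins j t x \<in> std_cube (Suc n)"
  by (auto simp: cube_ins_def std_cube_def)

lemma act_path_cube_map:
  assumes "g \<in> unit_paths" "k < n"
  shows "act_path k g \<in> cube_maps n n"
proof -
  have "continuous_on (std_cube n) (\<lambda>x. act_path k g x i)" for i
  proof (cases "i = k")
    case True
    have "continuous_on (std_cube n) (\<lambda>x. g (x k))"
      by (rule continuous_on_compose2[of "{0..1}" g])
        (use assms std_cubeD in \<open>auto simp: unit_paths_def intro: continuous_on_subset[OF continuous_on_product_coordinates]\<close>)
    with True show ?thesis by (simp add: act_path_def)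
  qed (auto simp: act_path_def intro: continuous_on_subset[OF continuous_on_product_coordinates])
  then show ?thesis
    using act_path_in_std_cube[OF assms]
    by (auto simp: cube_maps_def intro: continuous_on_coordinatewise_then_product)
qed

lemma act_square_cube_map:
  assumes "h \<in> unit_squares" "k < n"
  shows "act_square k h \<in> cube_maps (Suc n) n"
proof -
  have co: "continuous_on (std_cube (Suc n)) (\<lambda>x. x i)" for i
    by (auto intro: continuous_on_subset[OF continuous_on_product_coordinates])
  have "continuous_on (std_cube (Suc n)) (\<lambda>x. (\<lambda>(u, t). h u t) (x k, x (Suc k)))"
    by (rule continuous_on_compose2[of "{0..1} \<times> {0..1}" "\<lambda>(u, t). h u t"])
      (use assms std_cubeD[of _ "Suc n"] in \<open>auto simp: unit_squares_def intro!: continuous_on_Pair co\<close>)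
  then have "continuous_on (std_cube (Suc n)) (\<lambda>x. act_square k h x i)" for i
    using co by (cases i k rule: linorder_cases) (auto simp: act_square_def)
  then show ?thesis
    using act_square_in_std_cube[OF assms]
    by (auto simp: cube_maps_def intro: continuous_on_coordinatewise_then_product)
qed

lemma cube_ins_cube_map:
  assumes "t \<in> {0..1}" "j \<le> n"
  shows "cube_ins j t \<in> cube_maps n (Suc n)"
proof -
  have co: "continuous_on (std_cube n) (\<lambda>x. x i)" for i
    by (auto intro: continuous_on_subset[OF continuous_on_product_coordinates])
  then have "continuous_on (std_cube n) (\<lambda>x. cube_ins j t x i)" for i
    by (cases i j rule: linorder_cases) (auto simp: cube_ins_def)
  then show ?thesis
    using cube_ins_in_std_cube[OF assms]
    by (auto simp: cube_maps_def intro: continuous_on_coordinatewise_then_product)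
qed

lemma act_path_cube_ins:
  "k < j \<Longrightarrow> act_path k g (cube_ins j t x) = cube_ins j t (act_path k g x)"
  "j \<le> k \<Longrightarrow> act_path (Suc k) g (cube_ins j t x) = cube_ins j t (act_path k g x)"
  "act_path k g (cube_ins k t x) = cube_ins k (g t) x"
  by (auto simp: act_path_def cube_ins_def fun_eq_iff)

text \<open>The last two cases are the sides of the square: freezing either parameter leaves a path
  acting on coordinate \<open>k\<close>.\<close>

lemma act_square_cube_ins:
  "k < j \<Longrightarrow> act_square k h (cube_ins (Suc j) t x) = cube_ins j t (act_square k h x)"
  "j \<le> k \<Longrightarrow> act_square (Suc k) h (cube_ins j t x) = cube_ins j t (act_square k h x)"
  "act_square k h (cube_ins k t x) = act_path k (h t) x"
  "act_square k h (cube_ins (Suc k) t x) = act_path k (\<lambda>u. h u t) x"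
  by (auto simp: act_path_def act_square_def cube_ins_def fun_eq_iff Suc_diff_Suc less_Suc_eq)

section \<open>The boundary operator, coordinate by coordinate\<close>

definition bface :: "'r::comm_ring_1 \<Rightarrow> 'r \<Rightarrow> nat \<Rightarrow> nat \<Rightarrow> (((nat \<Rightarrow> real) \<Rightarrow> 'a) \<Rightarrow> 'r) \<Rightarrow> ((nat \<Rightarrow> real) \<Rightarrow> 'a) \<Rightarrow> 'r" where
  "bface a b j n \<phi> T = a * \<phi> (cube_face n j 0 T) + b * \<phi> (cube_face n j 1 T)"

definition cobd :: "'r::comm_ring_1 \<Rightarrow> 'r \<Rightarrow> nat \<Rightarrow> (((nat \<Rightarrow> real) \<Rightarrow> 'a) \<Rightarrow> 'r) \<Rightarrow> ((nat \<Rightarrow> real) \<Rightarrow> 'a) \<Rightarrow> 'r" where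
  "cobd a b n \<phi> T = (\<Sum>j<n. (-1) ^ j * bface a b j n \<phi> T)"

lemma chain_boundary_eq_push: "chain_boundary a b n c = push (cobd a b n) c"
  by (simp add: chain_boundary_def push_def pair_def cobd_def bface_def delta_def)

lemma finitary_cobd:
  "finitary (Collect (singular_cube n X)) (Collect (singular_cube (n - 1) X)) (cobd a b n)"
proof -
  have face: "finitary (Collect (singular_cube n X)) (Collect (singular_cube (n - 1) X))
      (\<lambda>\<phi> T. \<phi> (cube_face n j t T))" if "j < n" "t \<in> {0..1}" for j t
  proof -
    have "cube_ins j t \<in> cube_maps (n - 1) n"
      using cube_ins_cube_map[of t j "n - 1"] that by (cases n) auto
    then show ?thesis
      by (intro finitary_point) (auto simp: cube_face_eq_pullback singular_cube_pullback)
  qed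
  show ?thesis
    unfolding cobd_def[abs_def] bface_def
    by (intro finitary_sum finitary_add finitary_scale face) auto
qed

text \<open>Testing against all functions on points and on paths lets the two boundary relations be
  applied to any function of a reparametrised cube.\<close>

locale interval_subdivision =
  fixes a b :: "'r::comm_ring_1" and \<epsilon> :: real
    and s :: "('r \<times> (real \<Rightarrow> real)) list" and \<eta> :: "('r \<times> (real \<Rightarrow> real \<Rightarrow> real)) list"
  assumes s_small: "snd ` set s \<subseteq> small_paths \<epsilon>"
    and s_boundary: "lsum s (\<lambda>g. a * \<psi> (g 0) + b * \<psi> (g 1)) = a * \<psi> 0 + b * \<psi> 1"
    and \<eta>_squares: "snd ` set \<eta> \<subseteq> unit_squares"
    and \<eta>_boundary: "lsum \<eta> (\<lambda>h. (a * \<phi> (h 0) + b * \<phi> (h 1)) - (a * \<phi> (\<lambda>u. h u 0) + b * \<phi> (\<lambda>u. h u 1)))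
         = lsum s \<phi> - \<phi> (\<lambda>u. u)"
begin

definition sub1 :: "nat \<Rightarrow> nat \<Rightarrow> (((nat \<Rightarrow> real) \<Rightarrow> 'a) \<Rightarrow> 'r) \<Rightarrow> ((nat \<Rightarrow> real) \<Rightarrow> 'a) \<Rightarrow> 'r" where
  "sub1 k n \<phi> T = lsum s (\<lambda>g. \<phi> (pullback n (act_path k g) T))"

definition hty1 :: "nat \<Rightarrow> nat \<Rightarrow> (((nat \<Rightarrow> real) \<Rightarrow> 'a) \<Rightarrow> 'r) \<Rightarrow> ((nat \<Rightarrow> real) \<Rightarrow> 'a) \<Rightarrow> 'r" where
  "hty1 k n \<phi> T = lsum \<eta> (\<lambda>h. \<phi> (pullback (Suc n) (act_square k h) T))"

primrec sub :: "nat \<Rightarrow> nat \<Rightarrow> (((nat \<Rightarrow> real) \<Rightarrow> 'a) \<Rightarrow> 'r) \<Rightarrow> ((nat \<Rightarrow> real) \<Rightarrow> 'a) \<Rightarrow> 'r" where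
  "sub 0 n \<phi> = \<phi>"
| "sub (Suc k) n \<phi> = sub1 k n (sub k n \<phi>)"

text \<open>On chains \<open>\<eta>\<close> acts first, raising the dimension at coordinate
  \<open>k\<close>, and \<open>s\<close> then acts on the first \<open>k\<close> coordinates of an
  \<open>(n + 1)\<close>-cube; hence \<open>Suc n\<close> in \<open>sub\<close>.\<close>

definition hty :: "nat \<Rightarrow> (((nat \<Rightarrow> real) \<Rightarrow> 'a) \<Rightarrow> 'r) \<Rightarrow> ((nat \<Rightarrow> real) \<Rightarrow> 'a) \<Rightarrow> 'r" where
  "hty n \<phi> T = (\<Sum>k<n. (-1) ^ k * hty1 k n (sub k (Suc n) \<phi>) T)"

lemma s_unit: "g \<in> snd ` set s \<Longrightarrow> g \<in> unit_paths"
  using s_small small_paths_subset by blast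

lemma \<eta>_unit: "h \<in> snd ` set \<eta> \<Longrightarrow> h \<in> unit_squares"
  using \<eta>_squares by blast

lemma cube_face_pullback:
  assumes "t \<in> {0..1}" "j \<le> n"
  shows "cube_face (Suc n) j t (pullback (Suc n) G T) = pullback n (\<lambda>x. G (cube_ins j t x)) T"
  using assms by (simp add: cube_face_eq_pullback pullback_pullback cube_ins_in_std_cube)

text \<open>Acting on one coordinate commutes with freezing another. Freezing an earlier one shifts
  the index, hence a version for either order of \<open>j\<close> and \<open>k\<close>.\<close>

lemma sub1_bface_less:
  assumes "k < j" "j \<le> n"
  shows "sub1 k (Suc n) (bface a b j (Suc n) \<phi>) = bface a b j (Suc n) (sub1 k n \<phi>)"
proof
  fix T :: "(nat \<Rightarrow> real) \<Rightarrow> 'a"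
  have "cube_face (Suc n) j t (pullback (Suc n) (act_path k g) T)
      = pullback n (act_path k g) (cube_face (Suc n) j t T)"
    if "g \<in> snd ` set s" "t \<in> {0..1}" for g t
    using that assms s_unit[of g]
    by (simp add: cube_face_pullback act_path_cube_ins) 
       (simp add: cube_face_eq_pullback pullback_pullback act_path_in_std_cube)
  then show "sub1 k (Suc n) (bface a b j (Suc n) \<phi>) T = bface a b j (Suc n) (sub1 k n \<phi>) T"
    unfolding bface_def sub1_def lsum_mult[symmetric] lsum_add[symmetric]
    by (intro lsum_cong) auto
qed

lemma sub1_bface_greater:
  assumes "j \<le> k" "k < n"
  shows "sub1 (Suc k) (Suc n) (bface a b j (Suc n) \<phi>) = bface a b j (Suc n) (sub1 k n \<phi>)"
proof
  fix T :: "(nat \<Rightarrow> real) \<Rightarrow> 'a"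
  have "cube_face (Suc n) j t (pullback (Suc n) (act_path (Suc k) g) T)
      = pullback n (act_path k g) (cube_face (Suc n) j t T)"
    if "g \<in> snd ` set s" "t \<in> {0..1}" for g t
    using that assms s_unit[of g]
    by (simp add: cube_face_pullback act_path_cube_ins) 
       (simp add: cube_face_eq_pullback pullback_pullback act_path_in_std_cube)
  then show "sub1 (Suc k) (Suc n) (bface a b j (Suc n) \<phi>) T = bface a b j (Suc n) (sub1 k n \<phi>) T"
    unfolding bface_def sub1_def lsum_mult[symmetric] lsum_add[symmetric]
    by (intro lsum_cong) auto
qed

text \<open>\<open>s\<close> has the same boundary as the interval, so subdividing coordinate
  \<open>k\<close> is invisible on the faces in that direction.\<close>

lemma sub1_bface_eq:
  assumes "k \<le> n"
  shows "sub1 k (Suc n) (bface a b k (Suc n) \<phi>) = bface a b k (Suc n) \<phi>"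
proof
  fix T :: "(nat \<Rightarrow> real) \<Rightarrow> 'a"
  show "sub1 k (Suc n) (bface a b k (Suc n) \<phi>) T = bface a b k (Suc n) \<phi> T"
    using s_boundary[of "\<lambda>t. \<phi> (pullback n (cube_ins k t) T)"] assms
    unfolding bface_def sub1_def
    by (simp add: cube_face_pullback act_path_cube_ins) (simp add: cube_face_eq_pullback)
qed

text \<open>The square has two parameters but acts on one coordinate, so a face beyond it has index
  \<open>Suc j\<close> on one side and \<open>j\<close> on the other.\<close>

lemma hty1_bface_greater:
  assumes "k < j" "j \<le> n"
  shows "hty1 k (Suc n) (bface a b (Suc j) (Suc (Suc n)) \<phi>) = bface a b j (Suc n) (hty1 k n \<phi>)"
proof
  fix T :: "(nat \<Rightarrow> real) \<Rightarrow> 'a"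
  have "cube_face (Suc (Suc n)) (Suc j) t (pullback (Suc (Suc n)) (act_square k h) T)
      = pullback (Suc n) (act_square k h) (cube_face (Suc n) j t T)"
    if "h \<in> snd ` set \<eta>" "t \<in> {0..1}" for h t
    using that assms \<eta>_unit[of h]
    by (simp add: cube_face_pullback act_square_cube_ins) 
       (simp add: cube_face_eq_pullback pullback_pullback act_square_in_std_cube)
  then show "hty1 k (Suc n) (bface a b (Suc j) (Suc (Suc n)) \<phi>) T = bface a b j (Suc n) (hty1 k n \<phi>) T"
    unfolding bface_def hty1_def lsum_mult[symmetric] lsum_add[symmetric]
    by (intro lsum_cong) auto
qed

lemma hty1_bface_less:
  assumes "j \<le> k" "k < n"
  shows "hty1 (Suc k) (Suc n) (bface a b j (Suc (Suc n)) \<phi>) = bface a b j (Suc n) (hty1 k n \<phi>)"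
proof
  fix T :: "(nat \<Rightarrow> real) \<Rightarrow> 'a"
  have "cube_face (Suc (Suc n)) j t (pullback (Suc (Suc n)) (act_square (Suc k) h) T)
      = pullback (Suc n) (act_square k h) (cube_face (Suc n) j t T)"
    if "h \<in> snd ` set \<eta>" "t \<in> {0..1}" for h t
    using that assms \<eta>_unit[of h]
    by (simp add: cube_face_pullback act_square_cube_ins) 
       (simp add: cube_face_eq_pullback pullback_pullback act_square_in_std_cube)
  then show "hty1 (Suc k) (Suc n) (bface a b j (Suc (Suc n)) \<phi>) T = bface a b j (Suc n) (hty1 k n \<phi>) T"
    unfolding bface_def hty1_def lsum_mult[symmetric] lsum_add[symmetric]
    by (intro lsum_cong) auto
qed

text \<open>Here \<open>\<eta>_boundary\<close> enters: these faces are the sides of the square.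
  Extensionality makes the pullback along the identity return \<open>T\<close>.\<close>

lemma hty1_bface_eq:
  assumes "k < n" "T \<in> extensional (std_cube n)"
  shows "hty1 k n (bface a b k (Suc n) \<phi>) T - hty1 k n (bface a b (Suc k) (Suc n) \<phi>) T
       = sub1 k n \<phi> T - \<phi> T"
proof -
  have "act_path k (\<lambda>u. u) = (\<lambda>x. x)" by (auto simp: act_path_def)
  then have "pullback n (act_path k (\<lambda>u. u)) T = T"
    using assms(2) by (simp add: pullback_id)
  then show ?thesis
    using \<eta>_boundary[of "\<lambda>g. \<phi> (pullback n (act_path k g) T)"] assms(1)
    unfolding bface_def sub1_def hty1_def lsum_diff[symmetric]
    by (simp add: cube_face_pullback act_square_cube_ins)
qed

lemma sub_bface_ge: "k \<le> j \<Longrightarrow> j \<le> n \<Longrightarrow>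
  sub k (Suc n) (bface a b j (Suc n) \<phi>) = bface a b j (Suc n) (sub k n \<phi>)"
  by (induction k) (auto simp: sub1_bface_less)

text \<open>Of the coordinates \<open>0\<close> to \<open>k\<close>, coordinate \<open>j\<close> is
  absorbed by its own face and those above it move down by one, so one fewer remains to be
  subdivided.\<close>

lemma sub_bface_less: "j \<le> k \<Longrightarrow> k \<le> n \<Longrightarrow>
  sub (Suc k) (Suc n) (bface a b j (Suc n) \<phi>) = bface a b j (Suc n) (sub k n \<phi>)"
proof (induction k)
  case 0
  then show ?case by (simp add: sub1_bface_eq)
next
  case (Suc k)
  show ?case
  proof (cases "j = Suc k")
    case True
    have "sub (Suc k) (Suc n) (bface a b (Suc k) (Suc n) \<phi>)
        = bface a b (Suc k) (Suc n) (sub (Suc k) n \<phi>)"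
      using Suc.prems by (intro sub_bface_ge) auto
    with True Suc.prems show ?thesis
      by (simp only: sub.simps(2)[of "Suc k"] sub1_bface_eq)
  next
    case False
    then have "sub (Suc k) (Suc n) (bface a b j (Suc n) \<phi>) = bface a b j (Suc n) (sub k n \<phi>)"
      using Suc by auto
    with False Suc.prems show ?thesis
      by (simp only: sub.simps(2)[of "Suc k"]) (simp add: sub1_bface_greater)
  qed
qed

lemma finitary_sub1:
  "k < n \<Longrightarrow> finitary (Collect (singular_cube n X)) (Collect (singular_cube n X)) (sub1 k n)"
  unfolding sub1_def[abs_def]
  by (rule finitary_lsum) (auto intro!: singular_cube_pullback act_path_cube_map s_unit)

lemma finitary_hty1:
  "k < n \<Longrightarrow> finitary (Collect (singular_cube n X)) (Collect (singular_cube (Suc n) X)) (hty1 k n)"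
  unfolding hty1_def[abs_def]
  by (rule finitary_lsum) (auto intro!: singular_cube_pullback act_square_cube_map \<eta>_unit)

lemma finitary_sub:
  "k \<le> n \<Longrightarrow> finitary (Collect (singular_cube n X)) (Collect (singular_cube n X)) (sub k n)"
proof (induction k)
  case 0
  show ?case using finitary_point[of "\<lambda>T. T"] by (auto simp: sub.simps(1)[abs_def])
next
  case (Suc k)
  then show ?case
    by (auto simp: sub.simps(2)[abs_def] intro: finitary_comp[OF finitary_sub1])
qed

lemma finitary_hty:
  "finitary (Collect (singular_cube n X)) (Collect (singular_cube (Suc n) X)) (hty n)"
  unfolding hty_def[abs_def]
  by (intro finitary_sum finitary_comp[OF finitary_hty1 finitary_sub]) auto

text \<open>Without tracking where cubes lie, the indices and cubes are unconstrained; this form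
  serves to pull sums out of the operators.\<close>

lemma finitary_UNIV_sub: "finitary UNIV UNIV (sub k n)"
proof (induction k)
  case (Suc k)
  have "finitary UNIV UNIV (sub1 k n)"
    unfolding sub1_def[abs_def] by (rule finitary_lsum) auto
  then show ?case
    unfolding sub.simps(2)[abs_def] by (rule finitary_comp[OF _ Suc])
qed (use finitary_point[of "\<lambda>T. T"] in \<open>auto simp: sub.simps(1)[abs_def]\<close>)

lemma finitary_UNIV_hty1_sub: "finitary UNIV UNIV (\<lambda>\<phi>. hty1 k n (sub m n' \<phi>))"
proof -
  have "finitary UNIV UNIV (hty1 k n)"
    unfolding hty1_def[abs_def] by (rule finitary_lsum) auto
  then show ?thesis by (rule finitary_comp[OF _ finitary_UNIV_sub])
qed

text \<open>Transposed form of the statement that subdivision is a chain map: each face absorbs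
  exactly one of the \<open>n\<close> subdivided coordinates.\<close>

lemma sub_cobd: "sub n n (cobd a b n \<phi>) T = cobd a b n (sub (n - 1) (n - 1) \<phi>) T"
proof (cases n)
  case (Suc m)
  have "sub n n (cobd a b n \<phi>) T = (\<Sum>j<n. (-1) ^ j * sub n n (bface a b j n \<phi>) T)"
    unfolding cobd_def[abs_def] by (rule finitary_linear[OF finitary_UNIV_sub]) simp
  also have "\<dots> = (\<Sum>j<n. (-1) ^ j * bface a b j n (sub m m \<phi>) T)"
    using Suc by (intro sum.cong refl) (simp add: sub_bface_less del: sub.simps)
  finally show ?thesis using Suc by (simp add: cobd_def)
qed (simp add: cobd_def)

text \<open>The faces \<open>j < k\<close> and \<open>j > k + 1\<close> of the \<open>k\<close>-th homotopy cancel against the homotopy of the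
  boundary, and the faces \<open>k\<close> and \<open>k + 1\<close> telescope.\<close>

lemma hty_cobd:
  assumes "T \<in> extensional (std_cube n)"
  shows "hty n (cobd a b (Suc n) \<phi>) T + cobd a b n (hty (n - 1) \<phi>) T = sub n n \<phi> T - \<phi> T"
proof -
  \<comment> \<open>\<open>t k j\<close> comes from face \<open>j\<close> of the \<open>k\<close>-th
    term of the homotopy on \<open>T\<close>, and \<open>u k j\<close> from the \<open>k\<close>-th
    term of the homotopy on face \<open>j\<close> of \<open>T\<close>.\<close>
  define t where "t k j = hty1 k n (sub k (Suc n) (bface a b j (Suc n) \<phi>)) T" for k j
  define u where "u k j = bface a b j n (hty1 k (n - 1) (sub k n \<phi>)) T" for k j
  have row: "(\<Sum>j<Suc n. (-1) ^ j * t k j) = (\<Sum>j<k. (-1) ^ j * t k j)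
      + (-1) ^ k * (t k k - t k (Suc k)) + (\<Sum>j\<in>{Suc k..<n}. (-1) ^ Suc j * t k (Suc j))"
    if "k < n" for k
  proof -
    have "(\<Sum>j<Suc n. (-1) ^ j * t k j) = (\<Sum>j<k. (-1) ^ j * t k j)
      + (\<Sum>j\<in>{k..<Suc (Suc k)}. (-1) ^ j * t k j) + (\<Sum>j\<in>{Suc (Suc k)..<Suc n}. (-1) ^ j * t k j)"
      using that by (simp only: lessThan_atLeast0 sum.atLeastLessThan_concat)
    also have "(\<Sum>j\<in>{Suc (Suc k)..<Suc n}. (-1) ^ j * t k j) = (\<Sum>j\<in>{Suc k..<n}. (-1) ^ Suc j * t k (Suc j))"
      by (rule sum.shift_bounds_Suc_ivl)
    finally show ?thesis by (simp add: algebra_simps)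
  qed
  \<comment> \<open>A face before the square moves it down one position and absorbs one subdivided
    coordinate.\<close>
  have low: "t (Suc k) j = u k j" if "j \<le> k" "Suc k < n" for k j
    using that by (cases n) (auto simp: t_def u_def sub_bface_less hty1_bface_less simp del: sub.simps)
  have mid: "t k k - t k (Suc k) = sub (Suc k) n \<phi> T - sub k n \<phi> T" if "k < n" for k
    using that hty1_bface_eq[OF that assms, of "sub k n \<phi>"]
    by (simp add: t_def sub_bface_ge)
  have high: "t k (Suc j) = u k j" if "k < j" "j < n" for k j
    using that by (cases n) (auto simp: t_def u_def sub_bface_ge hty1_bface_greater simp del: sub.simps)
  have "hty n (cobd a b (Suc n) \<phi>) T = (\<Sum>k<n. (-1) ^ k * (\<Sum>j<Suc n. (-1) ^ j * t k j))"
    unfolding hty_def cobd_def[abs_def] t_def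
    by (intro sum.cong refl arg_cong2[where f = "(*)"] finitary_linear[OF finitary_UNIV_hty1_sub]) simp
  also have "\<dots> = (\<Sum>k<n. \<Sum>j<k. (-1) ^ (k + j) * t k j) + (\<Sum>k<n. t k k - t k (Suc k))
      - (\<Sum>k<n. \<Sum>j\<in>{Suc k..<n}. (-1) ^ (k + j) * t k (Suc j))"
  proof -
    have "(-1) ^ k * (\<Sum>j<Suc n. (-1) ^ j * t k j) = (\<Sum>j<k. (-1) ^ (k + j) * t k j)
      + (t k k - t k (Suc k)) - (\<Sum>j\<in>{Suc k..<n}. (-1) ^ (k + j) * t k (Suc j))" if "k < n" for k
    proof -
      have "(-1) ^ k * ((-1) ^ k * v) = v" for v :: 'r
        by (simp flip: mult.assoc power_add)
      then show ?thesis
        unfolding row[OF that]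
        by (simp add: distrib_left right_diff_distrib sum_distrib_left power_add sum_negf mult.assoc)
    qed
    then show ?thesis by (simp add: sum.distrib sum_subtractf)
  qed
  also have "(\<Sum>k<n. t k k - t k (Suc k)) = sub n n \<phi> T - \<phi> T"
  proof -
    have "(\<Sum>k<n. t k k - t k (Suc k)) = (\<Sum>k<n. sub (Suc k) n \<phi> T - sub k n \<phi> T)"
      using mid by simp
    also have "\<dots> = sub n n \<phi> T - sub 0 n \<phi> T"
      by (rule sum_lessThan_telescope)
    finally show ?thesis by simp
  qed
  \<comment> \<open>The summand for \<open>k = n - 1\<close> is empty.\<close>
  also have "(\<Sum>k<n. \<Sum>j\<in>{Suc k..<n}. (-1) ^ (k + j) * t k (Suc j))
      = (\<Sum>k<n - 1. \<Sum>j\<in>{Suc k..<n}. (-1) ^ (k + j) * u k j)"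
    by (cases n) (auto simp: high intro!: sum.cong)
  \<comment> \<open>The summand for \<open>k = 0\<close> is empty; shifting \<open>k\<close> by one
    then changes the sign.\<close>
  also have "(\<Sum>k<n. \<Sum>j<k. (-1) ^ (k + j) * t k j)
      = - (\<Sum>k<n - 1. \<Sum>j<Suc k. (-1) ^ (k + j) * u k j)"
  proof (cases n)
    case (Suc m)
    have "(\<Sum>k<n. \<Sum>j<k. (-1) ^ (k + j) * t k j) = (\<Sum>k<m. \<Sum>j<Suc k. (-1) ^ (Suc k + j) * t (Suc k) j)"
      unfolding Suc by (subst sum.lessThan_Suc_shift) simp
    also have "\<dots> = (\<Sum>k<m. \<Sum>j<Suc k. - ((-1) ^ (k + j) * u k j))"
      using Suc by (intro sum.cong refl) (simp add: low)
    finally show ?thesis using Suc by (simp only: sum_negf diff_Suc_1)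
  qed simp
  finally have 1: "hty n (cobd a b (Suc n) \<phi>) T = sub n n \<phi> T - \<phi> T
     - (\<Sum>k<n - 1. (\<Sum>j<Suc k. (-1) ^ (k + j) * u k j) + (\<Sum>j\<in>{Suc k..<n}. (-1) ^ (k + j) * u k j))"
    by (simp add: sum.distrib algebra_simps)
  have "(\<Sum>j<Suc k. (-1) ^ (k + j) * u k j) + (\<Sum>j\<in>{Suc k..<n}. (-1) ^ (k + j) * u k j)
      = (\<Sum>j<n. (-1) ^ (k + j) * u k j)" if "k < n - 1" for k
    using that by (simp only: lessThan_atLeast0 sum.atLeastLessThan_concat)
  then have 2: "hty n (cobd a b (Suc n) \<phi>) T = sub n n \<phi> T - \<phi> T
     - (\<Sum>k<n - 1. \<Sum>j<n. (-1) ^ (k + j) * u k j)"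
    unfolding 1 by simp
  have "cobd a b n (hty (n - 1) \<phi>) T = (\<Sum>j<n. \<Sum>k<n - 1. (-1) ^ (k + j) * u k j)"
    unfolding cobd_def
  proof (intro sum.cong refl)
    fix j assume "j \<in> {..<n}"
    then show "(-1) ^ j * bface a b j n (hty (n - 1) \<phi>) T = (\<Sum>k<n - 1. (-1) ^ (k + j) * u k j)"
      by (simp add: bface_def hty_def u_def sum_distrib_left sum.distrib power_add algebra_simps)
  qed
  also have "\<dots> = (\<Sum>k<n - 1. \<Sum>j<n. (-1) ^ (k + j) * u k j)"
    by (rule sum.swap)
  finally show ?thesis unfolding 2 by simp
qed

end

section \<open>Subdivision into small cubes\<close>

text \<open>The metric on functions sums the coordinate distances, capped at \<open>1\<close>, with
  geometric weights of total \<open>2\<close>.\<close>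

lemma dist_fun_le_of_coordinates:
  fixes x y :: "nat \<Rightarrow> real"
  assumes "\<And>i. \<bar>x i - y i\<bar> \<le> \<delta>"
  shows "dist x y \<le> 2 * \<delta>"
proof -
  have g: "summable (\<lambda>n. (1/2::real) ^ n)" "(\<Sum>n. (1/2::real) ^ n) = 2"
    by (auto simp: suminf_geometric)
  have le: "(1/2) ^ n * min (dist (x (from_nat n)) (y (from_nat n))) 1 \<le> (1/2) ^ n * \<delta>" for n
    using assms by (intro mult_left_mono) (auto simp: dist_real_def min_le_iff_disj)
  have "dist x y \<le> (\<Sum>n. (1/2) ^ n * \<delta>)"
    unfolding dist_fun_def
  proof (rule suminf_le[OF le])
    show "summable (\<lambda>n. (1/2) ^ n * \<delta>)" using g(1) by (rule summable_mult2)
    then show "summable (\<lambda>n. (1/2) ^ n * min (dist (x (from_nat n)) (y (from_nat n))) 1)"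
      by (rule summable_comparison_test'[where N = 0]) (use le in auto)
  qed
  also have "\<dots> = 2 * \<delta>"
    using suminf_mult2[OF g(1), of \<delta>] g(2) by simp
  finally show ?thesis .
qed

lemma compact_std_cube: "compact (std_cube n)"
proof -
  have "std_cube n = PiE UNIV (\<lambda>i. if i < n then {0..1} else {0})"
    by (auto simp: std_cube_def PiE_UNIV_domain Pi_def not_less)
  moreover have "compactin (powertop_real UNIV) (PiE UNIV (\<lambda>i. if i < n then {0..1} else {0}))"
    by (subst compactin_PiE) auto
  ultimately show ?thesis
    by (simp add: euclidean_product_topology)
qed

definition fine_maps :: "real \<Rightarrow> nat \<Rightarrow> ((nat \<Rightarrow> real) \<Rightarrow> nat \<Rightarrow> real) set" where
  "fine_maps \<epsilon> n = {G \<in> cube_maps n n.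
     \<forall>x\<in>std_cube n. \<forall>y\<in>std_cube n. \<forall>m<n. \<bar>G x m - G y m\<bar> \<le> \<epsilon>}"

lemma singular_cube_subtopology:
  "singular_cube n (subtopology X S) T \<longleftrightarrow> singular_cube n X T \<and> T ` std_cube n \<subseteq> S"
  by (auto simp: singular_cube_def continuous_map_in_subtopology)

text \<open>A Lebesgue number for the preimages of \<open>U\<close> and \<open>V\<close> in the
  compact cube. The threshold works for all larger \<open>M\<close>, so that one \<open>M\<close>
  can serve finitely many cubes.\<close>

lemma eventually_fine_in_cover:
  assumes T: "singular_cube n X T" and U: "openin X U" and V: "openin X V"
    and cover: "topspace X \<subseteq> U \<union> V"
  obtains N where "N > 0" "\<And>M G. M \<ge> N \<Longrightarrow> G \<in> fine_maps (1 / real M) n \<Longrightarrow>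
     singular_cube n (subtopology X U) (pullback n G T)
     \<or> singular_cube n (subtopology X V) (pullback n G T)"
proof -
  have Tc: "continuous_map (subtopology euclidean (std_cube n)) X T"
    using T by (simp add: singular_cube_def euclidean_product_topology)
  have pre: "\<exists>O'. open O' \<and> {x \<in> std_cube n. T x \<in> W} = O' \<inter> std_cube n" if "openin X W" for W
    using openin_continuous_map_preimage[OF Tc that] by (auto simp: openin_subtopology)
  obtain P where P: "open P" "{x \<in> std_cube n. T x \<in> U} = P \<inter> std_cube n"
    using pre[OF U] by blast
  obtain Q where Q: "open Q" "{x \<in> std_cube n. T x \<in> V} = Q \<inter> std_cube n"
    using pre[OF V] by blast
  have "std_cube n \<subseteq> \<Union> {P, Q}"
  proof
    fix x assume "x \<in> std_cube n"
    then have "T x \<in> U \<union> V"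
      using continuous_map_image_subset_topspace[OF Tc] cover by auto
    with \<open>x \<in> std_cube n\<close> P(2) Q(2) show "x \<in> \<Union> {P, Q}" by auto
  qed
  then obtain e where e: "e > 0" "\<And>x. x \<in> std_cube n \<Longrightarrow> \<exists>G\<in>{P, Q}. ball x e \<subseteq> G"
    using Heine_Borel_lemma[OF compact_std_cube, of n "{P, Q}"] P(1) Q(1) by auto
  \<comment> \<open>A coordinate oscillation of \<open>1 / M\<close> bounds the distance by
    \<open>2 / M\<close>.\<close>
  obtain N where N: "N > 0" "2 / e < real N"
    using reals_Archimedean2[of "2 / e"] e(1) by (metis divide_pos_pos gr0I less_numeral_extra(3) of_nat_0 order_less_trans zero_less_numeral)
  show ?thesis
  proof (rule that[OF N(1)])
    fix M G assume "M \<ge> N" and G: "G \<in> fine_maps (1 / real M) n"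
    then have "2 / e < real M" using N by linarith
    then have M: "2 * (1 / real M) < e" using e(1) \<open>M \<ge> N\<close> N(1) by (simp add: field_simps)
    have G0: "G \<in> cube_maps n n" using G by (simp add: fine_maps_def)
    then have Gin: "G x \<in> std_cube n" if "x \<in> std_cube n" for x
      using that by (auto simp: cube_maps_def)
    have 0: "(\<lambda>_. 0) \<in> std_cube n" by (simp add: std_cube_def)
    have near: "G x \<in> ball (G (\<lambda>_. 0)) e" if x: "x \<in> std_cube n" for x
    proof -
      have "\<bar>G (\<lambda>_. 0) m - G x m\<bar> \<le> 1 / real M" for m
        using G 0 x Gin[OF 0] Gin[OF x] by (cases "m < n") (auto simp: fine_maps_def std_cube_def)
      then have "dist (G (\<lambda>_. 0)) (G x) \<le> 2 * (1 / real M)"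
        by (rule dist_fun_le_of_coordinates)
      with M show ?thesis by simp
    qed
    obtain W where "W \<in> {P, Q}" "ball (G (\<lambda>_. 0)) e \<subseteq> W"
      using e(2)[OF Gin[OF 0]] by blast
    then have "(\<forall>x\<in>std_cube n. T (G x) \<in> U) \<or> (\<forall>x\<in>std_cube n. T (G x) \<in> V)"
      using near Gin P(2) Q(2) by blast
    with singular_cube_pullback[OF T G0]
    show "singular_cube n (subtopology X U) (pullback n G T)
     \<or> singular_cube n (subtopology X V) (pullback n G T)"
      by (auto simp: singular_cube_subtopology pullback_def)
  qed
qed

lemma finitary_pointwise: "(\<And>T. T \<in> P \<Longrightarrow> finitary {T} Q F) \<Longrightarrow> finitary P Q F"
  by (simp add: finitary_def)

context interval_subdivision
begin

text \<open>Invariant for the induction over coordinates: those not yet treated must equal the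
  original ones, so that the next path acts on \<open>x k\<close> itself.\<close>

definition part_fine_maps :: "nat \<Rightarrow> nat \<Rightarrow> ((nat \<Rightarrow> real) \<Rightarrow> nat \<Rightarrow> real) set" where
  "part_fine_maps k n = {G \<in> cube_maps n n. \<forall>x\<in>std_cube n. (\<forall>m\<ge>k. G x m = x m)
     \<and> (\<forall>y\<in>std_cube n. \<forall>m<k. \<bar>G x m - G y m\<bar> \<le> \<epsilon>)}"

lemma act_path_part_fine:
  assumes g: "g \<in> small_paths \<epsilon>" and k: "k < n" and G: "G \<in> part_fine_maps k n"
  shows "(\<lambda>x. act_path k g (G x)) \<in> part_fine_maps (Suc k) n"
proof -
  have a: "act_path k g \<in> cube_maps n n"
    using act_path_cube_map small_paths_subset g k by blast
  have G0: "continuous_on (std_cube n) G" "G ` std_cube n \<subseteq> std_cube n"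
    using G by (auto simp: part_fine_maps_def cube_maps_def)
  have "continuous_on (std_cube n) (\<lambda>x. act_path k g (G x))"
    by (rule continuous_on_compose2[of "std_cube n" "act_path k g"])
      (use a G0 in \<open>auto simp: cube_maps_def\<close>)
  moreover have "act_path k g (G x) \<in> std_cube n" if "x \<in> std_cube n" for x
    using a G0(2) that by (auto simp: cube_maps_def)
  moreover have "\<bar>g (x k) - g (y k)\<bar> \<le> \<epsilon>" if "x \<in> std_cube n" "y \<in> std_cube n" for x y
    using g std_cubeD[OF that(1) k] std_cubeD[OF that(2) k] by (auto simp: small_paths_def)
  ultimately show ?thesis
    using G by (auto simp: part_fine_maps_def cube_maps_def act_path_def less_Suc_eq)
qed

lemma finitary_sub_part_fine:
  assumes "k \<le> n" "T \<in> extensional (std_cube n)"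
  shows "finitary {T} ((\<lambda>G. pullback n G T) ` part_fine_maps k n) (sub k n)"
  using assms
\<comment> \<open>\<open>T\<close> is generalised because the induction hypothesis is applied to a
  pullback of \<open>T\<close>.\<close>
proof (induction k arbitrary: T)
  case 0
  have "(\<lambda>x. x) \<in> part_fine_maps 0 n"
    by (auto simp: part_fine_maps_def cube_maps_def)
  then have "T \<in> (\<lambda>G. pullback n G T) ` part_fine_maps 0 n"
    by (rule rev_image_eqI) (simp add: pullback_id 0)
  then show ?case
    unfolding sub.simps(1)[abs_def] by (intro finitary_point[of "\<lambda>T. T"]) simp
next
  case (Suc k)
  let ?Q = "(\<lambda>g. pullback n (act_path k g) T) ` snd ` set s"
  let ?R = "(\<lambda>G. pullback n G T) ` part_fine_maps (Suc k) n"
  have "finitary {T} ?Q (sub1 k n)"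
    unfolding sub1_def[abs_def] by (rule finitary_lsum) auto
  moreover have "finitary ?Q ?R (sub k n)"
  proof (rule finitary_pointwise)
    fix T' assume "T' \<in> ?Q"
    then obtain g where g: "g \<in> snd ` set s" "T' = pullback n (act_path k g) T" by auto
    have "finitary {T'} ((\<lambda>G. pullback n G T') ` part_fine_maps k n) (sub k n)"
      using Suc by (intro Suc.IH) (auto simp: g(2) pullback_extensional)
    moreover have "(\<lambda>G. pullback n G T') ` part_fine_maps k n \<subseteq> ?R"
    proof
      fix S assume "S \<in> (\<lambda>G. pullback n G T') ` part_fine_maps k n"
      then obtain G where G: "G \<in> part_fine_maps k n" "S = pullback n G T'" by blast
      have "S = pullback n (\<lambda>x. act_path k g (G x)) T"
        unfolding G(2) g(2) using G(1)
        by (intro pullback_pullback) (auto simp: part_fine_maps_def cube_maps_def)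
      moreover have "(\<lambda>x. act_path k g (G x)) \<in> part_fine_maps (Suc k) n"
        using g(1) s_small Suc.prems(1) by (intro act_path_part_fine G(1)) auto
      ultimately show "S \<in> ?R" by (rule image_eqI)
    qed
    ultimately show "finitary {T'} ?R (sub k n)" by (rule finitary_mono[OF _ order_refl])
  qed
  ultimately show ?case
    unfolding sub.simps(2)[abs_def] by (rule finitary_comp)
qed

lemma finitary_sub_fine:
  assumes "T \<in> extensional (std_cube n)"
  shows "finitary {T} ((\<lambda>G. pullback n G T) ` fine_maps \<epsilon> n) (sub n n)"
  by (rule finitary_mono[OF finitary_sub_part_fine])
     (use assms in \<open>auto simp: part_fine_maps_def fine_maps_def\<close>)

text \<open>Tested against \<open>delta S\<close>, both sides become pairings with \<open>c\<close>
  by \<open>pair_push\<close>, and \<open>sub_cobd\<close> identifies them.\<close>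

lemma chain_boundary_push_sub:
  assumes "c \<in> chains n Y"
  shows "chain_boundary a b n (push (sub n n) c) = push (sub (n - 1) (n - 1)) (chain_boundary a b n c)"
proof -
  have c: "c \<in> chain_on (Collect (singular_cube n Y))" using assms by (simp add: chains_eq_chain_on)
  show ?thesis
    unfolding chain_boundary_eq_push push_def[of "cobd a b n" "push _ _"] push_def[of "sub _ _" "push _ _"]
      pair_push[OF finitary_sub[OF order_refl] c] pair_push[OF finitary_cobd c]
    using sub_cobd[abs_def] by metis
qed

lemma push_hty:
  assumes "c \<in> chains n Y"
  shows "chain_boundary a b (Suc n) (push (hty n) c) S + push (hty (n - 1)) (chain_boundary a b n c) S
       = push (sub n n) c S - c S"
proof -
  have c: "c \<in> chain_on (Collect (singular_cube n Y))" using assms by (simp add: chains_eq_chain_on)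
  have "chain_boundary a b (Suc n) (push (hty n) c) S + push (hty (n - 1)) (chain_boundary a b n c) S
     = pair c (\<lambda>T. hty n (cobd a b (Suc n) (delta S)) T + cobd a b n (hty (n - 1) (delta S)) T)"
    unfolding chain_boundary_eq_push push_def[of "cobd a b (Suc n)" "push _ _"] push_def[of "hty _" "push _ _"]
      pair_push[OF finitary_hty c] pair_push[OF finitary_cobd c] pair_add_right ..
  also have "\<dots> = pair c (\<lambda>T. sub n n (delta S) T - delta S T)"
    by (rule pair_cong[OF c], rule hty_cobd) (simp add: singular_cube_def)
  also have "\<dots> = push (sub n n) c S - c S"
    by (simp add: pair_diff_right push_def pair_delta[OF c])
  finally show ?thesis .
qed

end

text \<open>The interface for excision. The same operators serve every topology \<open>Y\<close> on
  the point type, so chains of a subspace stay in that subspace.\<close>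

locale chain_subdivision =
  fixes a b :: "'r::comm_ring_1"
    and sd ht :: "nat \<Rightarrow> (((nat \<Rightarrow> real) \<Rightarrow> 'a) \<Rightarrow> 'r) \<Rightarrow> ((nat \<Rightarrow> real) \<Rightarrow> 'a) \<Rightarrow> 'r"
  assumes sd_chains: "d \<in> chains m Y \<Longrightarrow> sd m d \<in> chains m Y"
    and sd_add: "d \<in> chains m Y \<Longrightarrow> e \<in> chains m Y \<Longrightarrow> sd m (\<lambda>T. d T + e T) = (\<lambda>S. sd m d S + sd m e S)"
    and ht_chains: "d \<in> chains m Y \<Longrightarrow> ht m d \<in> chains (Suc m) Y"
    and ht_0: "ht 0 d = (\<lambda>_. 0)"
    and boundary_sd: "d \<in> chains m Y \<Longrightarrow> chain_boundary a b m (sd m d) = sd (m - 1) (chain_boundary a b m d)"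
    and boundary_ht: "d \<in> chains m Y \<Longrightarrow>
      chain_boundary a b (Suc m) (ht m d) S + ht (m - 1) (chain_boundary a b m d) S = sd m d S - d S"
begin

text \<open>For \<open>n = 0\<close> truncated subtraction gives \<open>n - 1 = 0\<close>, so \<open>ht_0\<close> is needed.\<close>

lemma ht_pred_chains: "d \<in> chains (n - 1) Y \<Longrightarrow> ht (n - 1) d \<in> chains n Y"
  using ht_chains[of d "n - 1" Y] by (cases n) (auto simp: ht_0 chains_eq_chain_on chain_on_zero)

end

text \<open>The fineness is chosen from the finitely many cubes of \<open>c\<close>. The operators
  thus depend on \<open>c\<close>, but their identities hold for all chains.\<close>

lemma exists_subdivision:
  fixes a b :: "'r::comm_ring_1" and X :: "'a topology"
  assumes ncd: "NCD a b" and c: "c \<in> chains n X"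
    and U: "openin X U" and V: "openin X V" and cover: "topspace X \<subseteq> U \<union> V"
  obtains sd ht where "chain_subdivision a b sd ht"
    and "sd n c \<in> chain_on {T. singular_cube n (subtopology X U) T \<or> singular_cube n (subtopology X V) T}"
proof -
  let ?Q = "{T. singular_cube n (subtopology X U) T \<or> singular_cube n (subtopology X V) T}"
  have c_fin: "finite {T. c T \<noteq> 0}" and c_sing: "\<And>T. c T \<noteq> 0 \<Longrightarrow> singular_cube n X T"
    using c by (auto simp: chains_def)
  have "\<forall>T. \<exists>N>0. c T \<noteq> 0 \<longrightarrow> (\<forall>M\<ge>N. \<forall>G\<in>fine_maps (1 / real M) n. pullback n G T \<in> ?Q)"
  proof
    fix T
    show "\<exists>N>0. c T \<noteq> 0 \<longrightarrow> (\<forall>M\<ge>N. \<forall>G\<in>fine_maps (1 / real M) n. pullback n G T \<in> ?Q)"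
    proof (cases "c T = 0")
      case False
      show ?thesis
        by (rule eventually_fine_in_cover[OF c_sing[OF False] U V cover]) blast
    qed auto
  qed
  then obtain N where N: "\<And>T. N T > (0::nat)"
    "\<And>T M G. c T \<noteq> 0 \<Longrightarrow> M \<ge> N T \<Longrightarrow> G \<in> fine_maps (1 / real M) n \<Longrightarrow> pullback n G T \<in> ?Q"
    by metis
  \<comment> \<open>\<open>insert 1\<close> provides a positive maximum also for
    \<open>c = 0\<close>.\<close>
  define M where "M = Max (insert 1 (N ` {T. c T \<noteq> 0}))"
  have M: "M > 0" "\<And>T. c T \<noteq> 0 \<Longrightarrow> N T \<le> M"
    using c_fin by (auto simp: M_def Max_gr_iff)
  obtain x y where xy: "x * a + y * b = 1"
    using ncd unfolding NCD_def by (metis power_one_right)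
  obtain s where s: "snd ` set s \<subseteq> small_paths (1 / real M)"
    "\<And>\<phi>. lsum s (\<lambda>g. a * \<phi> (g 0) + b * \<phi> (g 1)) = a * \<phi> 0 + b * \<phi> 1" "lsum s (\<lambda>_. 1) = 1"
    by (rule fine_interval_chain[OF xy M(1)]) (rule that)
  obtain \<eta> where \<eta>: "snd ` set \<eta> \<subseteq> unit_squares"
    "\<And>\<phi>. lsum \<eta> (\<lambda>h. (a * \<phi> (h 0) + b * \<phi> (h 1)) - (a * \<phi> (\<lambda>u. h u 0) + b * \<phi> (\<lambda>u. h u 1)))
         = lsum s \<phi> - \<phi> (\<lambda>u. u)"
    by (rule fine_interval_homotopy[OF xy s]) (rule that)
  interpret interval_subdivision a b "1 / real M" s \<eta>
    by unfold_locales (use s \<eta> in auto)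
  \<comment> \<open>Smallness is known only for the cubes of \<open>c\<close>, so the domain is the
    support of \<open>c\<close>.\<close>
  have fin: "finitary {T. c T \<noteq> 0} ?Q (sub n n)"
  proof (rule finitary_pointwise)
    fix T assume "T \<in> {T. c T \<noteq> 0}"
    then show "finitary {T} ?Q (sub n n)"
      using N(2)[of T] M(2)[of T] c_sing[of T]
      by (intro finitary_mono[OF finitary_sub_fine]) (auto simp: singular_cube_def)
  qed
  have "c \<in> chain_on {T. c T \<noteq> 0}" using c_fin by (simp add: chain_on_def)
  then have small: "push (sub n n) c \<in> chain_on ?Q" by (rule push_chain_on[OF fin])
  have "chain_subdivision a b (\<lambda>m. push (sub m m)) (\<lambda>m. push (hty m)
    :: (((nat \<Rightarrow> real) \<Rightarrow> 'a) \<Rightarrow> 'r) \<Rightarrow> ((nat \<Rightarrow> real) \<Rightarrow> 'a) \<Rightarrow> 'r)"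
  proof
    fix m Y and d :: "((nat \<Rightarrow> real) \<Rightarrow> 'a) \<Rightarrow> 'r" assume d: "d \<in> chains m Y"
    show "push (sub m m) d \<in> chains m Y"
      using d unfolding chains_eq_chain_on by (rule push_chain_on[OF finitary_sub[OF order_refl]])
    show "push (sub m m) (\<lambda>T. d T + e T) = (\<lambda>S. push (sub m m) d S + push (sub m m) e S)"
      if "e \<in> chains m Y" for e
      using d that unfolding chains_eq_chain_on by (rule push_add)
    show "push (hty m) d \<in> chains (Suc m) Y"
      using d unfolding chains_eq_chain_on by (rule push_chain_on[OF finitary_hty])
    show "chain_boundary a b m (push (sub m m) d) = push (sub (m - 1) (m - 1)) (chain_boundary a b m d)"
      using d by (rule chain_boundary_push_sub)
    show "chain_boundary a b (Suc m) (push (hty m) d) S + push (hty (m - 1)) (chain_boundary a b m d) S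
       = push (sub m m) d S - d S" for S
      using d by (rule push_hty)
  qed (simp add: push_def hty_def pair_def)
  from that[OF this small] show ?thesis .
qed

section \<open>Excision\<close>

lemma chains_add: "c \<in> chains n X \<Longrightarrow> d \<in> chains n X \<Longrightarrow> (\<lambda>T. c T + d T) \<in> chains n X"
  by (simp add: chains_eq_chain_on chain_on_add)

lemma chains_diff: "c \<in> chains n X \<Longrightarrow> d \<in> chains n X \<Longrightarrow> (\<lambda>T. c T - d T) \<in> chains n X"
  by (simp add: chains_eq_chain_on chain_on_diff)

lemma chains_scale: "c \<in> chains n X \<Longrightarrow> (\<lambda>T. r * c T) \<in> chains n X"
  by (simp add: chains_eq_chain_on chain_on_scale)

lemma chains_zero: "(\<lambda>T. 0) \<in> chains n X"
  by (simp add: chains_eq_chain_on chain_on_zero)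

lemma chains_subtopology_mono:
  "S \<subseteq> S' \<Longrightarrow> chains n (subtopology X S) \<subseteq> chains n (subtopology X S')"
  by (auto simp: chains_def singular_cube_subtopology)

lemma chains_subtopology: "chains n (subtopology X S) \<subseteq> chains n X"
  by (auto simp: chains_def singular_cube_subtopology)

lemma chains_subtopology_Int:
  "c \<in> chains n (subtopology X S) \<Longrightarrow> c \<in> chains n (subtopology X S')
    \<Longrightarrow> c \<in> chains n (subtopology X (S \<inter> S'))"
  by (auto simp: chains_def singular_cube_subtopology)

lemma chain_boundary_in_chains: "c \<in> chains n X \<Longrightarrow> chain_boundary a b n c \<in> chains (n - 1) X"
  unfolding chains_eq_chain_on chain_boundary_eq_push by (rule push_chain_on[OF finitary_cobd])

lemma chain_boundary_add:
  "c \<in> chains n X \<Longrightarrow> d \<in> chains n X \<Longrightarrow>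
    chain_boundary a b n (\<lambda>T. c T + d T) = (\<lambda>S. chain_boundary a b n c S + chain_boundary a b n d S)"
  unfolding chains_eq_chain_on chain_boundary_eq_push by (rule push_add)

lemma chain_boundary_scale:
  "c \<in> chains n X \<Longrightarrow> chain_boundary a b n (\<lambda>T. r * c T) = (\<lambda>S. r * chain_boundary a b n c S)"
  unfolding chains_eq_chain_on chain_boundary_eq_push by (rule push_scale)

lemma chain_boundary_diff:
  assumes "c \<in> chains n X" "d \<in> chains n X"
  shows "chain_boundary a b n (\<lambda>T. c T - d T) = (\<lambda>S. chain_boundary a b n c S - chain_boundary a b n d S)"
  using chain_boundary_add[OF assms(1) chains_scale[OF assms(2)], of a b "-1"]
    chain_boundary_scale[OF assms(2), of a b "-1"] by simp

section \<open>Relative boundaries and classes modulo them\<close>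

lemma rel_boundariesI:
  assumes "d \<in> chains (Suc n) X" "e \<in> chains n (subtopology X A)"
    and "\<And>T. f T = chain_boundary a b (Suc n) d T + e T"
  shows "f \<in> rel_boundaries a b n X A"
  using assms unfolding rel_boundaries_def by auto

lemma rel_boundariesE:
  assumes "f \<in> rel_boundaries a b n X A"
  obtains d e where "d \<in> chains (Suc n) X" "e \<in> chains n (subtopology X A)"
    "f = (\<lambda>T. chain_boundary a b (Suc n) d T + e T)"
  using assms unfolding rel_boundaries_def by auto

lemma rel_boundaries_add:
  assumes "f \<in> rel_boundaries a b n X A" "g \<in> rel_boundaries a b n X A"
  shows "(\<lambda>T. f T + g T) \<in> rel_boundaries a b n X A"
proof -
  obtain d e where d: "d \<in> chains (Suc n) X" "e \<in> chains n (subtopology X A)"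
    "f = (\<lambda>T. chain_boundary a b (Suc n) d T + e T)"
    using assms(1) by (rule rel_boundariesE)
  obtain d' e' where d': "d' \<in> chains (Suc n) X" "e' \<in> chains n (subtopology X A)"
    "g = (\<lambda>T. chain_boundary a b (Suc n) d' T + e' T)"
    using assms(2) by (rule rel_boundariesE)
  show ?thesis
    by (rule rel_boundariesI[OF chains_add[OF d(1) d'(1)] chains_add[OF d(2) d'(2)]])
       (simp add: d(3) d'(3) chain_boundary_add[OF d(1) d'(1)])
qed

lemma rel_boundaries_scale:
  assumes "f \<in> rel_boundaries a b n X A"
  shows "(\<lambda>T. r * f T) \<in> rel_boundaries a b n X A"
proof -
  obtain d e where d: "d \<in> chains (Suc n) X" "e \<in> chains n (subtopology X A)"
    "f = (\<lambda>T. chain_boundary a b (Suc n) d T + e T)"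
    using assms(1) by (rule rel_boundariesE)
  show ?thesis
    by (rule rel_boundariesI[OF chains_scale[OF d(1)] chains_scale[OF d(2)]])
       (simp add: d(3) chain_boundary_scale[OF d(1)] distrib_left)
qed

lemma rel_boundaries_diff:
  assumes "f \<in> rel_boundaries a b n X A" "g \<in> rel_boundaries a b n X A"
  shows "(\<lambda>T. f T - g T) \<in> rel_boundaries a b n X A"
  using rel_boundaries_add[OF assms(1) rel_boundaries_scale[OF assms(2), of "-1"]] by simp

lemma rel_boundaries_zero: "(\<lambda>T. 0) \<in> rel_boundaries a b n X A"
  using rel_boundariesI[OF chains_zero chains_zero, of "\<lambda>_. 0" a b n]
  by (simp add: chain_boundary_def)

lemma rel_boundaries_mono:
  fixes a b :: "'r::comm_ring_1"
  assumes "chains (Suc n) X' \<subseteq> (chains (Suc n) X :: (_ \<Rightarrow> 'r) set)"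
    and "chains n (subtopology X' A') \<subseteq> (chains n (subtopology X A) :: (_ \<Rightarrow> 'r) set)"
  shows "rel_boundaries a b n X' A' \<subseteq> rel_boundaries a b n X A"
  using assms unfolding rel_boundaries_def by blast

lemma mem_hom_class_self: "c \<in> hom_class a b n X A c"
  by (simp add: hom_class_def rel_boundaries_zero)

lemma hom_class_eq_iff:
  "hom_class a b n X A c = hom_class a b n X A d \<longleftrightarrow> (\<lambda>T. c T - d T) \<in> rel_boundaries a b n X A"
proof
  assume "hom_class a b n X A c = hom_class a b n X A d"
  then show "(\<lambda>T. c T - d T) \<in> rel_boundaries a b n X A"
    using mem_hom_class_self[of c a b n X A] by (simp add: hom_class_def)
next
  assume cd: "(\<lambda>T. c T - d T) \<in> rel_boundaries a b n X A"
  show "hom_class a b n X A c = hom_class a b n X A d"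
    unfolding hom_class_def
    using rel_boundaries_add[OF _ cd] rel_boundaries_diff[OF _ cd] by fastforce
qed

lemma hom_add_hom_class:
  "hom_add a b n X A (hom_class a b n X A c) (hom_class a b n X A d)
   = hom_class a b n X A (\<lambda>T. c T + d T)" (is "?L = ?R")
proof
  show "?L \<subseteq> ?R"
  proof
    fix e assume "e \<in> ?L"
    then obtain c' d' where cd: "(\<lambda>T. c' T - c T) \<in> rel_boundaries a b n X A"
      "(\<lambda>T. d' T - d T) \<in> rel_boundaries a b n X A"
      "(\<lambda>T. e T - (c' T + d' T)) \<in> rel_boundaries a b n X A"
      by (auto simp: hom_add_def hom_class_def)
    show "e \<in> ?R"
      using rel_boundaries_add[OF rel_boundaries_add[OF cd(3) cd(1)] cd(2)]
      by (simp add: hom_class_def algebra_simps)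
  qed
  show "?R \<subseteq> ?L"
    using mem_hom_class_self[of c a b n X A] mem_hom_class_self[of d a b n X A]
    unfolding hom_add_def by (force simp: hom_class_def)
qed

lemma hom_scale_hom_class:
  "hom_scale a b n X A r (hom_class a b n X A c) = hom_class a b n X A (\<lambda>T. r * c T)" (is "?L = ?R")
proof
  show "?L \<subseteq> ?R"
  proof
    fix e assume "e \<in> ?L"
    then obtain c' where c': "(\<lambda>T. c' T - c T) \<in> rel_boundaries a b n X A"
      "(\<lambda>T. e T - r * c' T) \<in> rel_boundaries a b n X A"
      by (auto simp: hom_scale_def hom_class_def)
    show "e \<in> ?R"
      using rel_boundaries_add[OF c'(2) rel_boundaries_scale[OF c'(1), of r]]
      by (simp add: hom_class_def algebra_simps)
  qed
  show "?R \<subseteq> ?L"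
    using mem_hom_class_self[of c a b n X A]
    unfolding hom_scale_def by (force simp: hom_class_def)
qed

lemma chain_map_id:
  assumes "c \<in> chains n X"
  shows "chain_map n id c = c"
proof
  fix S
  have "T \<in> extensional (std_cube n)" if "c T \<noteq> 0" for T
    using assms that by (auto simp: chains_def singular_cube_def)
  then have "{T. c T \<noteq> 0 \<and> restrict (id \<circ> T) (std_cube n) = S} = (if c S \<noteq> 0 then {S} else {})"
    by (auto simp: extensional_restrict)
  then show "chain_map n id c S = c S"
    by (simp add: chain_map_def)
qed

text \<open>Every representative of the class of \<open>c\<close> over \<open>X'\<close> differs
  from \<open>c\<close> by a chain of \<open>X'\<close>, hence is itself one and is fixed by
  \<open>chain_map n id\<close>.\<close>

lemma hom_induced_id_hom_class:
  assumes X': "\<And>m. chains m X' \<subseteq> (chains m X :: (_ \<Rightarrow> 'r::comm_ring_1) set)"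
    and A': "\<And>m. chains m (subtopology X' A') \<subseteq> (chains m (subtopology X A) :: (_ \<Rightarrow> 'r) set)"
    and c: "c \<in> chains n X'"
  shows "hom_induced a b n X A id (hom_class a b n X' A' c) = hom_class a b n X A (c :: _ \<Rightarrow> 'r)"
    (is "?L = ?R")
proof
  have mono: "rel_boundaries a b n X' A' \<subseteq> rel_boundaries a b n X A"
    by (rule rel_boundaries_mono[OF X' A'])
  show "?L \<subseteq> ?R"
  proof
    fix e assume "e \<in> ?L"
    then obtain c' where c': "(\<lambda>T. c' T - c T) \<in> rel_boundaries a b n X' A'"
      "(\<lambda>T. e T - chain_map n id c' T) \<in> rel_boundaries a b n X A"
      by (auto simp: hom_induced_def hom_class_def)
    obtain d f where df: "d \<in> chains (Suc n) X'" "f \<in> chains n (subtopology X' A')"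
      "(\<lambda>T. c' T - c T) = (\<lambda>T. chain_boundary a b (Suc n) d T + f T)"
      using c'(1) by (rule rel_boundariesE)
    have "(\<lambda>T. chain_boundary a b (Suc n) d T + f T) \<in> chains n X'"
      using chain_boundary_in_chains[OF df(1)] subsetD[OF chains_subtopology df(2)]
      by (intro chains_add) auto
    then have "(\<lambda>T. (c' T - c T) + c T) \<in> chains n X'"
      unfolding df(3)[symmetric] using c by (rule chains_add)
    then have "chain_map n id c' = c'" by (intro chain_map_id) simp
    then show "e \<in> ?R"
      using rel_boundaries_add[OF c'(2) subsetD[OF mono c'(1)]] by (simp add: hom_class_def)
  qed
  show "?R \<subseteq> ?L"
  proof
    fix e assume "e \<in> ?R"
    then have "(\<lambda>T. e T - chain_map n id c T) \<in> rel_boundaries a b n X A"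
      by (simp add: hom_class_def chain_map_id[OF c])
    with mem_hom_class_self[of c a b n X' A'] show "e \<in> ?L"
      unfolding hom_induced_def by blast
  qed
qed

lemma chain_on_split:
  assumes "c \<in> chain_on {T. singular_cube n Y T \<or> singular_cube n Z T}"
  obtains c' c'' where "c' \<in> chains n Y" "c'' \<in> chains n Z" "c = (\<lambda>T. c' T + c'' T)"
proof
  \<comment> \<open>Cubes lying in both spaces go to the first summand.\<close>
  let ?c' = "\<lambda>T. if singular_cube n Y T then c T else 0"
  let ?c'' = "\<lambda>T. if singular_cube n Y T then 0 else c T"
  have fin: "finite {T. c T \<noteq> 0}" using assms by (simp add: chain_on_def)
  have "finite {T. ?c' T \<noteq> 0}" "finite {T. ?c'' T \<noteq> 0}"
    by (auto intro!: finite_subset[OF _ fin])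
  then show "?c' \<in> chains n Y" "?c'' \<in> chains n Z"
    unfolding chains_def using assms by (auto simp: chain_on_def)
qed auto

section \<open>The two halves of excision\<close>

context
  fixes X :: "'a topology" and A B :: "'a set" and a b :: "'r::comm_ring_1"
  assumes AX: "A \<subseteq> topspace X" and BA: "B \<subseteq> A"
    and cl: "X closure_of B \<subseteq> X interior_of A" and ncd: "NCD a b"
begin

abbreviation (input) "excised \<equiv> subtopology X (topspace X - B)"

text \<open>The intersection is the form in which \<open>chains_subtopology_Int\<close> shows that a
  chain lies in the excised subspace.\<close>

lemma subtopology_excised: "subtopology excised (A - B) = subtopology X ((topspace X - B) \<inter> A)"
  using AX by (auto simp: subtopology_subtopology intro!: arg_cong[where f = "subtopology X"])

lemma excision_subdivision:
  fixes c :: "((nat \<Rightarrow> real) \<Rightarrow> 'a) \<Rightarrow> 'r"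
  assumes c: "c \<in> chains n X"
  obtains sd ht c' c'' where "chain_subdivision a b sd ht"
    and "c' \<in> chains n excised" "c'' \<in> chains n (subtopology X A)" "sd n c = (\<lambda>T. c' T + c'' T)"
proof -
  \<comment> \<open>These open sets cover \<open>X\<close> because the closure of \<open>B\<close>
    lies in the interior of \<open>A\<close>. Cubes in the first avoid \<open>B\<close>, cubes in
    the second lie in \<open>A\<close>.\<close>
  let ?U = "topspace X - X closure_of B" and ?V = "X interior_of A"
  have BX: "B \<subseteq> X closure_of B" using AX BA by (intro closure_of_subset) auto
  have "openin X ?U" "openin X ?V" "topspace X \<subseteq> ?U \<union> ?V"
    using cl by (auto intro: openin_diff)
  with exists_subdivision[OF ncd c] obtain sd ht where sd: "chain_subdivision a b sd ht"
    and small: "sd n c \<in> chain_on {T. singular_cube n (subtopology X ?U) T \<or> singular_cube n (subtopology X ?V) T}"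
    by blast
  obtain c' c'' where c': "c' \<in> chains n (subtopology X ?U)" "c'' \<in> chains n (subtopology X ?V)"
    "sd n c = (\<lambda>T. c' T + c'' T)"
    by (rule chain_on_split[OF small])
  have "c' \<in> chains n excised"
    using c'(1) BX chains_subtopology_mono[of ?U "topspace X - B"] by blast
  moreover have "c'' \<in> chains n (subtopology X A)"
    using c'(2) chains_subtopology_mono[OF interior_of_subset] by blast
  ultimately show ?thesis using c'(3) by (rule that[OF sd])
qed

text \<open>After subdivision the part \<open>c''\<close> in \<open>A\<close> is discarded. The
  boundary of the rest avoids \<open>B\<close> by construction, and lies in \<open>A\<close> as the
  subdivided boundary of \<open>c\<close> minus the boundary of \<open>c''\<close>.\<close>

lemma excision_surj:
  assumes c: "c \<in> rel_cycles a b n X A"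
  obtains c' where "c' \<in> rel_cycles a b n excised (A - B)" "(\<lambda>T. c' T - c T) \<in> rel_boundaries a b n X A"
proof -
  have cX: "c \<in> chains n X" and dc: "chain_boundary a b n c \<in> chains (n - 1) (subtopology X A)"
    using c by (auto simp: rel_cycles_def)
  obtain sd ht c' c'' where sd: "chain_subdivision a b sd ht"
    and c': "c' \<in> chains n excised" "c'' \<in> chains n (subtopology X A)" "sd n c = (\<lambda>T. c' T + c'' T)"
    by (rule excision_subdivision[OF cX])
  interpret chain_subdivision a b sd ht by (rule sd)
  have c''X: "c'' \<in> chains n X" using c'(2) chains_subtopology by blast
  have "chain_boundary a b n c' = chain_boundary a b n (\<lambda>T. sd n c T - c'' T)"
    by (simp add: c'(3))
  also have "\<dots> = (\<lambda>T. sd (n - 1) (chain_boundary a b n c) T - chain_boundary a b n c'' T)"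
    unfolding chain_boundary_diff[OF sd_chains[OF cX] c''X] boundary_sd[OF cX] ..
  also have "\<dots> \<in> chains (n - 1) (subtopology X A)"
    by (rule chains_diff[OF sd_chains[OF dc] chain_boundary_in_chains[OF c'(2)]])
  finally have "chain_boundary a b n c' \<in> chains (n - 1) (subtopology excised (A - B))"
    unfolding subtopology_excised by (rule chains_subtopology_Int[OF chain_boundary_in_chains[OF c'(1)]])
  with c'(1) have "c' \<in> rel_cycles a b n excised (A - B)" by (simp add: rel_cycles_def)
  moreover have "(\<lambda>T. c' T - c T) \<in> rel_boundaries a b n X A"
  \<comment> \<open>The homotopy applied to the boundary of \<open>c\<close> stays in
    \<open>A\<close>, so it joins \<open>c''\<close> in the part that vanishes in the
    quotient.\<close>
  proof (rule rel_boundariesI[OF ht_chains[OF cX] chains_diff[OF ht_pred_chains[OF dc] c'(2)]])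
    fix T
    show "c' T - c T = chain_boundary a b (Suc n) (ht n c) T
        + (ht (n - 1) (chain_boundary a b n c) T - c'' T)"
      using boundary_ht[OF cX, of T] c'(3) by (simp add: algebra_simps)
  qed
  ultimately show ?thesis by (rule that)
qed

text \<open>If \<open>c\<close> bounds \<open>d\<close> modulo \<open>A\<close>, the part
  \<open>d'\<close> of the subdivided \<open>d\<close> bounds the subdivided \<open>c\<close> up to
  an error \<open>v\<close> in the excised subspace. The homotopy back to \<open>c\<close> stays
  inside the excised pair.\<close>

lemma excision_inj:
  assumes c: "c \<in> rel_cycles a b n excised (A - B)" and bd: "c \<in> rel_boundaries a b n X A"
  shows "c \<in> rel_boundaries a b n excised (A - B)"
proof -
  have cX: "c \<in> chains n excised" and dc: "chain_boundary a b n c \<in> chains (n - 1) (subtopology excised (A - B))"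
    using c by (auto simp: rel_cycles_def)
  obtain d e where d: "d \<in> chains (Suc n) X" and e: "e \<in> chains n (subtopology X A)"
    and c_eq: "c = (\<lambda>T. chain_boundary a b (Suc n) d T + e T)"
    using bd by (rule rel_boundariesE)
  obtain sd ht d' d'' where sd: "chain_subdivision a b sd ht"
    and d': "d' \<in> chains (Suc n) excised" "d'' \<in> chains (Suc n) (subtopology X A)"
      "sd (Suc n) d = (\<lambda>T. d' T + d'' T)"
    by (rule excision_subdivision[OF d])
  interpret chain_subdivision a b sd ht by (rule sd)
  have ext: "d' \<in> chains (Suc n) X" "d'' \<in> chains (Suc n) X"
    using d' chains_subtopology by blast+
  \<comment> \<open>This form shows that \<open>v\<close> lies in \<open>A\<close>. As
    \<open>sd n c\<close> minus the boundary of \<open>d'\<close> it also avoids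
    \<open>B\<close>.\<close>
  define v where "v = (\<lambda>T. chain_boundary a b (Suc n) d'' T + sd n e T)"
  have sd_c: "sd n c T = chain_boundary a b (Suc n) d' T + v T" for T
  proof -
    have "sd n c = (\<lambda>T. sd n (chain_boundary a b (Suc n) d) T + sd n e T)"
      unfolding c_eq
      by (rule sd_add) (use chain_boundary_in_chains[OF d] subsetD[OF chains_subtopology e] in auto)
    also have "sd n (chain_boundary a b (Suc n) d) = chain_boundary a b (Suc n) (\<lambda>T. d' T + d'' T)"
      using boundary_sd[OF d] d'(3) by simp
    finally show ?thesis
      by (simp add: v_def chain_boundary_add[OF ext])
  qed
  have "v \<in> chains n (subtopology X A)"
    unfolding v_def using chain_boundary_in_chains[OF d'(2)] sd_chains[OF e] by (simp add: chains_add)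
  moreover have "(\<lambda>T. sd n c T - chain_boundary a b (Suc n) d' T) \<in> chains n excised"
    using chain_boundary_in_chains[OF d'(1)] sd_chains[OF cX] by (simp add: chains_diff)
  then have "v \<in> chains n excised" by (simp add: sd_c)
  ultimately have v: "v \<in> chains n (subtopology excised (A - B))"
    unfolding subtopology_excised by (intro chains_subtopology_Int)
  show ?thesis
  proof (rule rel_boundariesI[OF chains_diff[OF d'(1) ht_chains[OF cX]] chains_diff[OF v ht_pred_chains[OF dc]]])
    fix T
    show "c T = chain_boundary a b (Suc n) (\<lambda>T. d' T - ht n c T) T
        + (v T - ht (n - 1) (chain_boundary a b n c) T)"
      using boundary_ht[OF cX, of T] sd_c[of T]
      by (simp add: chain_boundary_diff[OF d'(1) ht_chains[OF cX]] algebra_simps)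
  qed
qed

end

theorem mainTheorem5:
  fixes X :: "'a topology" and A B :: "'a set" and a b :: "'r::comm_ring_1"
  assumes "A \<subseteq> topspace X" and "B \<subseteq> A"
    and "X closure_of B \<subseteq> X interior_of A"
    and "NCD a b"
  shows "\<forall>n. bij_betw (hom_induced a b n X A id)
               (rel_homology a b n (subtopology X (topspace X - B)) (A - B))
               (rel_homology a b n X A)
           \<and> (\<forall>C\<in>rel_homology a b n (subtopology X (topspace X - B)) (A - B).
               \<forall>D\<in>rel_homology a b n (subtopology X (topspace X - B)) (A - B).
                 hom_induced a b n X A id (hom_add a b n (subtopology X (topspace X - B)) (A - B) C D)
                 = hom_add a b n X A (hom_induced a b n X A id C) (hom_induced a b n X A id D))
           \<and> (\<forall>r. \<forall>C\<in>rel_homology a b n (subtopology X (topspace X - B)) (A - B).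
                 hom_induced a b n X A id (hom_scale a b n (subtopology X (topspace X - B)) (A - B) r C)
                 = hom_scale a b n X A r (hom_induced a b n X A id C))"
proof
  fix n
  let ?X' = "subtopology X (topspace X - B)" and ?A' = "A - B"
  let ?f = "hom_induced a b n X A id"
  let ?cl' = "hom_class a b n ?X' ?A'" and ?cl = "hom_class a b n X A"
  have sub_A: "chains m (subtopology ?X' ?A') \<subseteq> (chains m (subtopology X A) :: (_ \<Rightarrow> 'r) set)" for m
    unfolding subtopology_excised[OF assms] by (rule chains_subtopology_mono) auto
  have f: "?f (?cl' c) = ?cl c" if "c \<in> chains n ?X'" for c
    using chains_subtopology sub_A that by (rule hom_induced_id_hom_class)
  have cyc: "rel_cycles a b n ?X' ?A' \<subseteq> rel_cycles a b n X A"
    using sub_A chains_subtopology unfolding rel_cycles_def by blast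
  have cyc_ch: "c \<in> chains n ?X'" if "c \<in> rel_cycles a b n ?X' ?A'" for c
    using that by (simp add: rel_cycles_def)
  have "inj_on ?f (rel_homology a b n ?X' ?A')"
  proof (rule inj_onI)
    fix C D assume "C \<in> rel_homology a b n ?X' ?A'" "D \<in> rel_homology a b n ?X' ?A'" and eq: "?f C = ?f D"
    then obtain c d where c: "c \<in> rel_cycles a b n ?X' ?A'" "C = ?cl' c"
      and d: "d \<in> rel_cycles a b n ?X' ?A'" "D = ?cl' d"
      by (auto simp: rel_homology_def)
    have "(\<lambda>T. c T - d T) \<in> rel_boundaries a b n X A"
      using eq by (simp add: c d f cyc_ch hom_class_eq_iff)
    moreover have "(\<lambda>T. c T - d T) \<in> rel_cycles a b n ?X' ?A'"
      using c(1) d(1) by (auto simp: rel_cycles_def chains_diff chain_boundary_diff)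
    ultimately have "(\<lambda>T. c T - d T) \<in> rel_boundaries a b n ?X' ?A'"
      using excision_inj[OF assms] by blast
    then show "C = D" by (simp add: c d hom_class_eq_iff)
  qed
  moreover have "?f ` rel_homology a b n ?X' ?A' = rel_homology a b n X A"
  proof -
    have "?f ` rel_homology a b n ?X' ?A' = ?cl ` rel_cycles a b n ?X' ?A'"
      unfolding rel_homology_def image_image by (rule image_cong) (auto simp: f cyc_ch)
    \<comment> \<open>Surjectivity: every class of \<open>(X, A)\<close> has a representative that
      is a relative cycle of the excised pair.\<close>
    also have "\<dots> = ?cl ` rel_cycles a b n X A"
    proof
      show "?cl ` rel_cycles a b n X A \<subseteq> ?cl ` rel_cycles a b n ?X' ?A'"
      proof (rule image_subsetI)
        fix c assume "c \<in> rel_cycles a b n X A"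
        then obtain c' where "c' \<in> rel_cycles a b n ?X' ?A'" "(\<lambda>T. c' T - c T) \<in> rel_boundaries a b n X A"
          by (rule excision_surj[OF assms])
        then show "?cl c \<in> ?cl ` rel_cycles a b n ?X' ?A'"
          by (intro rev_image_eqI[of c']) (simp_all add: hom_class_eq_iff[symmetric])
      qed
    qed (use cyc in auto)
    finally show ?thesis by (simp add: rel_homology_def)
  qed
  moreover have "?f (hom_add a b n ?X' ?A' C D) = hom_add a b n X A (?f C) (?f D)"
    if "C \<in> rel_homology a b n ?X' ?A'" "D \<in> rel_homology a b n ?X' ?A'" for C D
    using that by (auto simp: rel_homology_def hom_add_hom_class f cyc_ch chains_add)
  moreover have "?f (hom_scale a b n ?X' ?A' r C) = hom_scale a b n X A r (?f C)"
    if "C \<in> rel_homology a b n ?X' ?A'" for r C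
    using that by (auto simp: rel_homology_def hom_scale_hom_class f cyc_ch chains_scale)
  ultimately show "bij_betw ?f (rel_homology a b n ?X' ?A') (rel_homology a b n X A)
     \<and> (\<forall>C\<in>rel_homology a b n ?X' ?A'. \<forall>D\<in>rel_homology a b n ?X' ?A'.
          ?f (hom_add a b n ?X' ?A' C D) = hom_add a b n X A (?f C) (?f D))
     \<and> (\<forall>r. \<forall>C\<in>rel_homology a b n ?X' ?A'.
          ?f (hom_scale a b n ?X' ?A' r C) = hom_scale a b n X A r (?f C))"
    by (auto simp: bij_betw_def)
qed

end
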